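(* Let $H$ be a Hopf algebra with bijective antipode over a field $k$, let $C$ be a right $H$-module coalgebra, and let $\tau,\lambda$ be twistings of the right $H$-module coalgebra $C\otimes H$. Let $C\rtimes_{\alpha}H$ (with weak coaction $\rho$) and $C\rtimes'_{\alpha'}H$ (with weak coaction $\rho'$) be the crossed coproducts corresponding to $\tau$ and $\lambda$, respectively. Then $\tau$ and $\lambda$ are equivalent if and only if there is a left $C$-colinear, right $H$-linear coalgebra isomorphism between $C\rtimes_{\alpha}H$ and $C\rtimes'_{\alpha'}H$.
   Context: All maps are $k$-linear; $\Delta(c)=c_1\otimes c_2$ (Sweedler notation, summation understood); $S$ is the antipode of $H$. A right $H$-module coalgebra is a coalgebra $D$ that is a right $H$-module with $\Delta(d\cdot h)=d_1\cdot h_1\otimes d_2\cdot h_2$ and $\varepsilon_D(d\cdot h)=\varepsilon_D(d)\varepsilon_H(h)$. $C\otimes H$ is the tensor product coalgebra, with right $H$-action $(c\otimes h)\cdot g=c\otimes hg$. Twistings. Let $D$ be a right $H$-module coalgebra, $\tau\in\mathrm{Hom}(D,H\otimes D)$, $\tau(d)=d_{-1}\otimes d_0$, normalized: $d_{-1}\varepsilon_D(d_0)=\varepsilon_D(d)1_H$ and $\varepsilon_H(d_{-1})d_0=d$. Let $D^\tau$ be $D$ as a right $H$-module, with comultiplication $\Delta_\tau(d)=d_1\cdot d_{2.-1}\otimes d_{2.0}$, where $\tau(d_2)=d_{2.-1}\otimes d_{2.0}$. $\mathcal M_H^D$ is the category of right $H$-modules and right $D$-comodules $M$ with $\rho(m\cdot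 h)=m_0\cdot h_1\otimes m_1\cdot h_2$; for such $M$, $M^\tau$ is $M$ as an $H$-module with $\rho^\tau(m)=m_0\cdot m_{1.-1}\otimes m_{1.0}$. A normalized $\tau$ is called a twisting of $D$ if $D^\tau$ is a right $H$-module coalgebra and $M^\tau\in\mathcal M_H^{D^\tau}$ for all $M\in\mathcal M_H^D$. It is known that a normalized $\tau$ is a twisting if and only if, for all $d\in D,h\in H$: $d_{-1}h_1\otimes d_0\cdot h_2=h_1(d\cdot h_2)_{-1}\otimes(d\cdot h_2)_0$ and $d_{-1}\otimes d_{0.1}\cdot d_{0.2.-1}\otimes d_{0.2.0}=d_{1.-1}d_{2.-1.1}\otimes d_{1.0}\cdot d_{2.-1.2}\otimes d_{2.0}$ (a final numerical index $.1$ or $.2$ denotes a component of the original comultiplication of $D$ or of $H$). Equivalence. Twistings $\tau(d)=d_{-1}\otimes d_0$ and $\lambda(d)=d_{(-1)}\otimes d_{(0)}$ of $D$ are equivalent if there is a convolution invertible $v\in\mathrm{Hom}(D,H)$ such that for all $d\in D,h\in H$: $\varepsilon_H\circ v=\varepsilon_D$; $v(d\cdot h)=S(h_1)v(d)h_2$; and $d_{1.(-1)}v(d_2)_1\otimes d_{1.(0)}\cdot v(d_2)_2=v(d_1)d_{2.-1}\otimes d_{2.0.1}\cdot v(d_{2.0.2})$, where $\lambda(d_1)=d_{1.(-1)}\otimes d_{1.(0)}$, $\tau(d_2)=d_{2.-1}\otimes d_{2.0}$, $d_{2.0.1}\otimes d_{2.0.2}=\Delta(d_{2.0})$. Crossed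 coproducts. A weak coaction of $H$ on $C$ is a map $\rho:C\to H\otimes C$, $\rho(c)=c_{[-1]}\otimes c_{[0]}$, with $c_{[-1]}\otimes c_{[0]1}\otimes c_{[0]2}=c_{1[-1]}c_{2[-1]}\otimes c_{1[0]}\otimes c_{2[0]}$, $\varepsilon_C(c_{[0]})c_{[-1]}=\varepsilon_C(c)1_H$, $\varepsilon_H(c_{[-1]})c_{[0]}=c$. A Harrison 2-cocycle (for $\rho$) is a map $\alpha:C\to H\otimes H$, $\alpha(c)=\alpha_1(c)\otimes\alpha_2(c)$, with $(\varepsilon_H\otimes id)\alpha(c)=(id\otimes\varepsilon_H)\alpha(c)=\varepsilon_C(c)1_H$, $c_{1[-1]}\alpha_1(c_2)\otimes\alpha_1(c_{1[0]})\alpha_2(c_2)_1\otimes\alpha_2(c_{1[0]})\alpha_2(c_2)_2=\alpha_1(c_1)\alpha_1(c_2)_1\otimes\alpha_2(c_1)\alpha_1(c_2)_2\otimes\alpha_2(c_2)$, and $c_{1[-1]}\alpha_1(c_2)\otimes c_{1[0][-1]}\alpha_2(c_2)\otimes c_{1[0][0]}=\alpha_1(c_1)c_{2[-1]1}\otimes\alpha_2(c_1)c_{2[-1]2}\otimes c_{2[0]}$. Given such $\rho,\alpha$, the crossed coproduct $C\rtimes_\alpha H$ is the coalgebra with underlying space $C\otimes H$, comultiplication $\Delta_\alpha(c\otimes h)=(c_1\otimes c_{2[-1]}\alpha_1(c_3)h_1)\otimes(c_{2[0]}\otimes\alpha_2(c_3)h_2)$ and counit $\varepsilon_C\otimes\varepsilon_H$;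 it is a right $H$-module by multiplication on $H$ and a left $C$-comodule via $c\otimes h\mapsto c_1\otimes(c_2\otimes h)$. Correspondence. It is known that twistings $\tau$ of $C\otimes H$ correspond bijectively to crossed coproduct structures on $C\otimes H$: to $\tau$ correspond the weak coaction $\rho(c)=(id\otimes id\otimes\varepsilon_H)\tau(c\otimes1)$ and the Harrison 2-cocycle $\alpha(c)=(id\otimes\varepsilon_C\otimes id)\tau(c\otimes1)$, and then $(C\otimes H)^\tau=C\rtimes_\alpha H$; conversely $\tau(c\otimes h)=S(h_1)c_{1[-1]}\alpha_1(c_2)h_2\otimes c_{1[0]}\otimes\alpha_2(c_2)h_3$. *)

theory Defs
  imports Complex_Main "HOL-Library.Function_Algebras"
begin

section \<open>Vector spaces, linear and bilinear maps\<close>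

text \<open>
  A vector space is a subspace \<open>carr V\<close> of a type that is itself a vector space under
  \<open>scl V\<close>. Carriers are needed because a tensor product depends on the scalar actions and is
  therefore not a type; a vector space given as a type has \<open>carr V = UNIV\<close>.
  Maps are total functions, only their values on carriers matter.
\<close>

record ('k, 'v) vs =
  carr :: "'v set"
  scl :: "'k \<Rightarrow> 'v \<Rightarrow> 'v"

definition vspace :: "('k::field, 'v::ab_group_add, 'z) vs_scheme \<Rightarrow> bool" where
  "vspace V \<longleftrightarrow> vector_space (scl V) \<and> module.subspace (scl V) (carr V)"

definition ground :: "('k::field, 'k) vs" where
  "ground = \<lparr>carr = UNIV, scl = (*)\<rparr>"

definition klinear ::
  "('k::field, 'v::ab_group_add, 'y) vs_scheme \<Rightarrow> ('k, 'w::ab_group_add, 'z) vs_scheme \<Rightarrow>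
    ('v \<Rightarrow> 'w) \<Rightarrow> bool" where
  "klinear V W f \<longleftrightarrow>
    (\<forall>x\<in>carr V. f x \<in> carr W) \<and>
    (\<forall>x\<in>carr V. \<forall>y\<in>carr V. f (x + y) = f x + f y) \<and>
    (\<forall>a. \<forall>x\<in>carr V. f (scl V a x) = scl W a (f x))"

definition kbilinear ::
  "('k::field, 'v::ab_group_add, 'x) vs_scheme \<Rightarrow> ('k, 'w::ab_group_add, 'y) vs_scheme \<Rightarrow>
    ('k, 'u::ab_group_add, 'z) vs_scheme \<Rightarrow> ('v \<Rightarrow> 'w \<Rightarrow> 'u) \<Rightarrow> bool" where
  "kbilinear V W U b \<longleftrightarrow>
    (\<forall>x\<in>carr V. klinear W U (b x)) \<and> (\<forall>y\<in>carr W. klinear V U (\<lambda>x. b x y))"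


section \<open>Tensor products\<close>

text \<open>
  Over a field the canonical map from \<open>V \<otimes> W\<close> to the dual of the space of bilinear forms on
  \<open>V \<times> W\<close> is injective. The tensor product is realised as its image: \<open>x \<otimes> y\<close> is evaluation at
  \<open>(x, y)\<close>, and \<open>V \<otimes> W\<close> is the span of these elements. The universal property is proved below.
\<close>

type_synonym ('k, 'v, 'w) tensor = "('v \<Rightarrow> 'w \<Rightarrow> 'k) \<Rightarrow> 'k"

definition pure_tensor ::
  "'v::ab_group_add \<Rightarrow> ('k::field, 'v, 'y) vs_scheme \<Rightarrow> ('k, 'w::ab_group_add, 'z) vs_scheme \<Rightarrow>
    'w \<Rightarrow> ('k, 'v, 'w) tensor" ("_ \<otimes>[_,/ _] _" [81, 0, 0, 80] 80) where
  "x \<otimes>[V, W] y = (\<lambda>\<beta>. if kbilinear V W ground \<beta> then \<beta> x y else 0)"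

definition tensor_space ::
  "('k::field, 'v::ab_group_add, 'y) vs_scheme \<Rightarrow> ('k, 'w::ab_group_add, 'z) vs_scheme \<Rightarrow>
    ('k, ('k, 'v, 'w) tensor) vs" (infixr "\<odot>" 85) where
  "V \<odot> W =
    \<lparr>carr = module.span (\<lambda>a T \<beta>. a * T \<beta>) {x \<otimes>[V, W] y |x y. x \<in> carr V \<and> y \<in> carr W},
     scl = (\<lambda>a T \<beta>. a * T \<beta>)\<rparr>"

text \<open>
  Sweedler notation: \<open>sw V W T (\<lambda>x y. b x y)\<close> is \<open>\<Sum> b x\<^sub>i y\<^sub>i\<close> where \<open>T = \<Sum> x\<^sub>i \<otimes> y\<^sub>i\<close> is any
  representation of \<open>T \<in> V \<otimes> W\<close>, i.e. the value at \<open>T\<close> of the linear map induced by the bilinear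
  map \<open>b\<close>. It does not depend on the representation (\<open>sw_eq\<close> below).
\<close>

definition sw ::
  "('k::field, 'v::ab_group_add, 'y) vs_scheme \<Rightarrow> ('k, 'w::ab_group_add, 'z) vs_scheme \<Rightarrow>
    ('k, 'v, 'w) tensor \<Rightarrow> ('v \<Rightarrow> 'w \<Rightarrow> 'u::ab_group_add) \<Rightarrow> 'u" where
  "sw V W T b =
    (let xs = (SOME xs. set xs \<subseteq> carr V \<times> carr W \<and> T = (\<Sum>(x, y)\<leftarrow>xs. x \<otimes>[V, W] y))
     in \<Sum>(x, y)\<leftarrow>xs. b x y)"


section \<open>Coalgebras and Hopf algebras\<close>

record ('k, 'd) coalg = "('k, 'd) vs" +
  comult :: "'d \<Rightarrow> ('k, 'd, 'd) tensor"
  counit :: "'d \<Rightarrow> 'k"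

definition coalgebra :: "('k::field, 'd::ab_group_add, 'z) coalg_scheme \<Rightarrow> bool" where
  "coalgebra D \<longleftrightarrow>
    vspace D \<and> klinear D (D \<odot> D) (comult D) \<and> klinear D ground (counit D) \<and>
    (\<forall>d\<in>carr D.
      sw D D (comult D d) (\<lambda>d1 d2. sw D D (comult D d1) (\<lambda>x y. x \<otimes>[D, D \<odot> D] (y \<otimes>[D, D] d2))) =
      sw D D (comult D d) (\<lambda>d1 d2. sw D D (comult D d2) (\<lambda>x y. d1 \<otimes>[D, D \<odot> D] (x \<otimes>[D, D] y)))) \<and>
    (\<forall>d\<in>carr D. sw D D (comult D d) (\<lambda>d1 d2. scl D (counit D d1) d2) = d) \<and>
    (\<forall>d\<in>carr D. sw D D (comult D d) (\<lambda>d1 d2. scl D (counit D d2) d1) = d)"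

definition coalgebra_map ::
  "('k::field, 'd::ab_group_add, 'y) coalg_scheme \<Rightarrow> ('k, 'e::ab_group_add, 'z) coalg_scheme \<Rightarrow>
    ('d \<Rightarrow> 'e) \<Rightarrow> bool" where
  "coalgebra_map D E f \<longleftrightarrow>
    klinear D E f \<and>
    (\<forall>d\<in>carr D. comult E (f d) = sw D D (comult D d) (\<lambda>d1 d2. f d1 \<otimes>[E, E] f d2)) \<and>
    (\<forall>d\<in>carr D. counit E (f d) = counit D d)"

text \<open>
  The Hopf algebra lives on a whole type of class \<open>ring_1\<close>, whose ring structure is its
  multiplication and unit; the requirement \<open>0 \<noteq> 1\<close> of that class holds in every Hopf algebra
  over a field since the counit maps \<open>1\<close> to \<open>1\<close>.
\<close>

record ('k, 'h) hopf = "('k, 'h) coalg" +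
  antipode :: "'h \<Rightarrow> 'h"

definition hopf_algebra :: "('k::field, 'h::ring_1, 'z) hopf_scheme \<Rightarrow> bool" where
  "hopf_algebra H \<longleftrightarrow>
    coalgebra H \<and> carr H = UNIV \<and>
    (\<forall>a x y. scl H a (x * y) = scl H a x * y \<and> scl H a (x * y) = x * scl H a y) \<and>
    (\<forall>x y. comult H (x * y) =
      sw H H (comult H x) (\<lambda>x1 x2. sw H H (comult H y) (\<lambda>y1 y2. (x1 * y1) \<otimes>[H, H] (x2 * y2)))) \<and>
    comult H 1 = 1 \<otimes>[H, H] 1 \<and>
    (\<forall>x y. counit H (x * y) = counit H x * counit H y) \<and>
    counit H 1 = 1 \<and>
    klinear H H (antipode H) \<and>
    (\<forall>x. sw H H (comult H x) (\<lambda>x1 x2. antipode H x1 * x2) = scl H (counit H x) 1) \<and>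
    (\<forall>x. sw H H (comult H x) (\<lambda>x1 x2. x1 * antipode H x2) = scl H (counit H x) 1)"


section \<open>Module coalgebras and Hopf modules\<close>

definition right_module ::
  "('k::field, 'h::ring_1, 'y) hopf_scheme \<Rightarrow> ('k, 'm::ab_group_add, 'z) vs_scheme \<Rightarrow>
    ('m \<Rightarrow> 'h \<Rightarrow> 'm) \<Rightarrow> bool" where
  "right_module H M r \<longleftrightarrow>
    vspace M \<and> kbilinear M H M r \<and>
    (\<forall>m\<in>carr M. r m 1 = m) \<and>
    (\<forall>m\<in>carr M. \<forall>g h. r (r m g) h = r m (g * h))"

record ('k, 'h, 'd) mcoalg = "('k, 'd) coalg" +
  act :: "'d \<Rightarrow> 'h \<Rightarrow> 'd"

definition module_coalgebra ::
  "('k::field, 'h::ring_1, 'y) hopf_scheme \<Rightarrow> ('k, 'h, 'd::ab_group_add, 'z) mcoalg_scheme \<Rightarrow> bool"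
where
  "module_coalgebra H D \<longleftrightarrow>
    coalgebra D \<and> right_module H D (act D) \<and>
    (\<forall>d\<in>carr D. \<forall>h. comult D (act D d h) =
      sw D D (comult D d) (\<lambda>d1 d2. sw H H (comult H h) (\<lambda>h1 h2. act D d1 h1 \<otimes>[D, D] act D d2 h2))) \<and>
    (\<forall>d\<in>carr D. \<forall>h. counit D (act D d h) = counit D d * counit H h)"

record ('k, 'h, 'd, 'm) hmod = "('k, 'm) vs" +
  hact :: "'m \<Rightarrow> 'h \<Rightarrow> 'm"
  coact :: "'m \<Rightarrow> ('k, 'm, 'd) tensor"

text \<open>Membership in the category \<open>\<M>\<^sub>H\<^sup>D\<close>.\<close>

definition hopf_module ::
  "('k::field, 'h::ring_1, 'x) hopf_scheme \<Rightarrow> ('k, 'h, 'd::ab_group_add, 'y) mcoalg_scheme \<Rightarrow>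
    ('k, 'h, 'd, 'm::ab_group_add, 'z) hmod_scheme \<Rightarrow> bool" where
  "hopf_module H D M \<longleftrightarrow>
    right_module H M (hact M) \<and>
    klinear M (M \<odot> D) (coact M) \<and>
    (\<forall>m\<in>carr M.
      sw M D (coact M m) (\<lambda>m0 m1. sw M D (coact M m0) (\<lambda>x y. x \<otimes>[M, D \<odot> D] (y \<otimes>[D, D] m1))) =
      sw M D (coact M m) (\<lambda>m0 m1. sw D D (comult D m1) (\<lambda>x y. m0 \<otimes>[M, D \<odot> D] (x \<otimes>[D, D] y)))) \<and>
    (\<forall>m\<in>carr M. sw M D (coact M m) (\<lambda>m0 m1. scl M (counit D m1) m0) = m) \<and>
    (\<forall>m\<in>carr M. \<forall>h. coact M (hact M m h) =
      sw M D (coact M m) (\<lambda>m0 m1. sw H H (comult H h) (\<lambda>h1 h2. hact M m0 h1 \<otimes>[M, D] act D m1 h2)))"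


section \<open>Twistings and their equivalence\<close>

definition normalized ::
  "('k::field, 'h::ring_1, 'y) hopf_scheme \<Rightarrow> ('k, 'h, 'd::ab_group_add, 'z) mcoalg_scheme \<Rightarrow>
    ('d \<Rightarrow> ('k, 'h, 'd) tensor) \<Rightarrow> bool" where
  "normalized H D \<tau> \<longleftrightarrow>
    klinear D (H \<odot> D) \<tau> \<and>
    (\<forall>d\<in>carr D. sw H D (\<tau> d) (\<lambda>x e. scl H (counit D e) x) = scl H (counit D d) 1) \<and>
    (\<forall>d\<in>carr D. sw H D (\<tau> d) (\<lambda>x e. scl D (counit H x) e) = d)"

definition twist_coalg ::
  "('k::field, 'h::ring_1, 'y) hopf_scheme \<Rightarrow> ('k, 'h, 'd::ab_group_add, 'z) mcoalg_scheme \<Rightarrow>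
    ('d \<Rightarrow> ('k, 'h, 'd) tensor) \<Rightarrow> ('k, 'h, 'd, 'z) mcoalg_scheme" where
  "twist_coalg H D \<tau> = D\<lparr>comult := \<lambda>d.
    sw D D (comult D d) (\<lambda>d1 d2. sw H D (\<tau> d2) (\<lambda>x e. act D d1 x \<otimes>[D, D] e))\<rparr>"

definition twist_module ::
  "('k::field, 'h::ring_1, 'x) hopf_scheme \<Rightarrow> ('k, 'h, 'd::ab_group_add, 'y) mcoalg_scheme \<Rightarrow>
    ('d \<Rightarrow> ('k, 'h, 'd) tensor) \<Rightarrow> ('k, 'h, 'd, 'm::ab_group_add, 'z) hmod_scheme \<Rightarrow>
    ('k, 'h, 'd, 'm, 'z) hmod_scheme" where
  "twist_module H D \<tau> M = M\<lparr>coact := \<lambda>m.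
    sw M D (coact M m) (\<lambda>m0 m1. sw H D (\<tau> m1) (\<lambda>x e. hact M m0 x \<otimes>[M, D] e))\<rparr>"

text \<open>
  HOL formulas cannot quantify over types, so \<open>M\<close> ranges over the Hopf modules carried by
  subsets of the type of \<open>H \<otimes> D\<close>. This is no restriction: \<open>H \<otimes> D\<close> with
  \<open>(h \<otimes> d) \<cdot> g = h g\<^sub>1 \<otimes> d \<cdot> g\<^sub>2\<close> and \<open>\<rho>(h \<otimes> d) = (h \<otimes> d\<^sub>1) \<otimes> d\<^sub>2\<close> is among them, and the
  condition for this single Hopf module already gives the equations on \<open>\<tau>\<close> that imply it for
  all Hopf modules.
\<close>

definition twisting ::
  "('k::field, 'h::ring_1, 'y) hopf_scheme \<Rightarrow> ('k, 'h, 'd::ab_group_add, 'z) mcoalg_scheme \<Rightarrow>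
    ('d \<Rightarrow> ('k, 'h, 'd) tensor) \<Rightarrow> bool" where
  "twisting H D \<tau> \<longleftrightarrow>
    normalized H D \<tau> \<and>
    module_coalgebra H (twist_coalg H D \<tau>) \<and>
    (\<forall>M :: ('k, 'h, 'd, ('k, 'h, 'd) tensor) hmod.
      hopf_module H D M \<longrightarrow> hopf_module H (twist_coalg H D \<tau>) (twist_module H D \<tau> M))"

definition conv_invertible ::
  "('k::field, 'h::ring_1, 'y) hopf_scheme \<Rightarrow> ('k, 'd::ab_group_add, 'z) coalg_scheme \<Rightarrow>
    ('d \<Rightarrow> 'h) \<Rightarrow> bool" where
  "conv_invertible H D v \<longleftrightarrow>
    klinear D H v \<and>
    (\<exists>w. klinear D H w \<and>
      (\<forall>d\<in>carr D. sw D D (comult D d) (\<lambda>d1 d2. v d1 * w d2) = scl H (counit D d) 1) \<and>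
      (\<forall>d\<in>carr D. sw D D (comult D d) (\<lambda>d1 d2. w d1 * v d2) = scl H (counit D d) 1))"

definition equivalent_twistings ::
  "('k::field, 'h::ring_1, 'y) hopf_scheme \<Rightarrow> ('k, 'h, 'd::ab_group_add, 'z) mcoalg_scheme \<Rightarrow>
    ('d \<Rightarrow> ('k, 'h, 'd) tensor) \<Rightarrow> ('d \<Rightarrow> ('k, 'h, 'd) tensor) \<Rightarrow> bool" where
  "equivalent_twistings H D \<tau> \<tau>' \<longleftrightarrow>
    (\<exists>v. conv_invertible H D v \<and>
      (\<forall>d\<in>carr D. counit H (v d) = counit D d) \<and>
      (\<forall>d\<in>carr D. \<forall>h. v (act D d h) =
        sw H H (comult H h) (\<lambda>h1 h2. antipode H h1 * v d * h2)) \<and>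
      (\<forall>d\<in>carr D.
        sw D D (comult D d) (\<lambda>d1 d2. sw H D (\<tau>' d1) (\<lambda>x e.
          sw H H (comult H (v d2)) (\<lambda>p q. (x * p) \<otimes>[H, D] act D e q))) =
        sw D D (comult D d) (\<lambda>d1 d2. sw H D (\<tau> d2) (\<lambda>x e.
          sw D D (comult D e) (\<lambda>e1 e2. (v d1 * x) \<otimes>[H, D] act D e1 (v e2))))))"


section \<open>The module coalgebra \<open>C \<otimes> H\<close> and crossed coproducts\<close>

definition tensor_counit ::
  "('k::field, 'h::ring_1, 'y) hopf_scheme \<Rightarrow> ('k, 'c::ab_group_add, 'z) coalg_scheme \<Rightarrow>
    ('k, 'c, 'h) tensor \<Rightarrow> 'k" where
  "tensor_counit H C t = sw C H t (\<lambda>c h. counit C c * counit H h)"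

definition tensor_act ::
  "('k::field, 'h::ring_1, 'y) hopf_scheme \<Rightarrow> ('k, 'c::ab_group_add, 'z) coalg_scheme \<Rightarrow>
    ('k, 'c, 'h) tensor \<Rightarrow> 'h \<Rightarrow> ('k, 'c, 'h) tensor" where
  "tensor_act H C t g = sw C H t (\<lambda>c h. c \<otimes>[C, H] (h * g))"

definition tensor_coalg ::
  "('k::field, 'h::ring_1, 'y) hopf_scheme \<Rightarrow> ('k, 'c::ab_group_add, 'z) coalg_scheme \<Rightarrow>
    ('k, 'h, ('k, 'c, 'h) tensor) mcoalg" where
  "tensor_coalg H C =
    \<lparr>carr = carr (C \<odot> H), scl = scl (C \<odot> H),
     comult = (\<lambda>t. sw C H t (\<lambda>c h. sw C C (comult C c) (\<lambda>c1 c2. sw H H (comult H h) (\<lambda>h1 h2.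
       (c1 \<otimes>[C, H] h1) \<otimes>[C \<odot> H, C \<odot> H] (c2 \<otimes>[C, H] h2))))),
     counit = tensor_counit H C,
     act = tensor_act H C\<rparr>"

definition weak_coaction ::
  "('k::field, 'h::ring_1, 'y) hopf_scheme \<Rightarrow> ('k, 'c::ab_group_add, 'z) coalg_scheme \<Rightarrow>
    ('c \<Rightarrow> ('k, 'h, 'c) tensor) \<Rightarrow> bool" where
  "weak_coaction H C \<rho> \<longleftrightarrow>
    klinear C (H \<odot> C) \<rho> \<and>
    (\<forall>c\<in>carr C.
      sw H C (\<rho> c) (\<lambda>x e. sw C C (comult C e) (\<lambda>e1 e2. x \<otimes>[H, C \<odot> C] (e1 \<otimes>[C, C] e2))) =
      sw C C (comult C c) (\<lambda>c1 c2. sw H C (\<rho> c1) (\<lambda>x e. sw H C (\<rho> c2) (\<lambda>y f.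
        (x * y) \<otimes>[H, C \<odot> C] (e \<otimes>[C, C] f))))) \<and>
    (\<forall>c\<in>carr C. sw H C (\<rho> c) (\<lambda>x e. scl H (counit C e) x) = scl H (counit C c) 1) \<and>
    (\<forall>c\<in>carr C. sw H C (\<rho> c) (\<lambda>x e. scl C (counit H x) e) = c)"

definition harrison_cocycle ::
  "('k::field, 'h::ring_1, 'y) hopf_scheme \<Rightarrow> ('k, 'c::ab_group_add, 'z) coalg_scheme \<Rightarrow>
    ('c \<Rightarrow> ('k, 'h, 'c) tensor) \<Rightarrow> ('c \<Rightarrow> ('k, 'h, 'h) tensor) \<Rightarrow> bool" where
  "harrison_cocycle H C \<rho> \<alpha> \<longleftrightarrow>
    klinear C (H \<odot> H) \<alpha> \<and>
    (\<forall>c\<in>carr C. sw H H (\<alpha> c) (\<lambda>a b. scl H (counit H a) b) = scl H (counit C c) 1) \<and>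
    (\<forall>c\<in>carr C. sw H H (\<alpha> c) (\<lambda>a b. scl H (counit H b) a) = scl H (counit C c) 1) \<and>
    (\<forall>c\<in>carr C.
      sw C C (comult C c) (\<lambda>c1 c2. sw H C (\<rho> c1) (\<lambda>x e. sw H H (\<alpha> e) (\<lambda>a b.
        sw H H (\<alpha> c2) (\<lambda>a' b'. sw H H (comult H b') (\<lambda>p q.
          (x * a') \<otimes>[H, H \<odot> H] ((a * p) \<otimes>[H, H] (b * q))))))) =
      sw C C (comult C c) (\<lambda>c1 c2. sw H H (\<alpha> c1) (\<lambda>a b. sw H H (\<alpha> c2) (\<lambda>a' b'.
        sw H H (comult H a') (\<lambda>p q. (a * p) \<otimes>[H, H \<odot> H] ((b * q) \<otimes>[H, H] b')))))) \<and>
    (\<forall>c\<in>carr C.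
      sw C C (comult C c) (\<lambda>c1 c2. sw H C (\<rho> c1) (\<lambda>x e. sw H C (\<rho> e) (\<lambda>y f.
        sw H H (\<alpha> c2) (\<lambda>a b. (x * a) \<otimes>[H, H \<odot> C] ((y * b) \<otimes>[H, C] f))))) =
      sw C C (comult C c) (\<lambda>c1 c2. sw H H (\<alpha> c1) (\<lambda>a b. sw H C (\<rho> c2) (\<lambda>x e.
        sw H H (comult H x) (\<lambda>p q. (a * p) \<otimes>[H, H \<odot> C] ((b * q) \<otimes>[H, C] e))))))"

definition crossed_coproduct ::
  "('k::field, 'h::ring_1, 'y) hopf_scheme \<Rightarrow> ('k, 'c::ab_group_add, 'z) coalg_scheme \<Rightarrow>
    ('c \<Rightarrow> ('k, 'h, 'c) tensor) \<Rightarrow> ('c \<Rightarrow> ('k, 'h, 'h) tensor) \<Rightarrow>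
    ('k, 'h, ('k, 'c, 'h) tensor) mcoalg" where
  "crossed_coproduct H C \<rho> \<alpha> =
    \<lparr>carr = carr (C \<odot> H), scl = scl (C \<odot> H),
     comult = (\<lambda>t. sw C H t (\<lambda>c h.
       sw C C (comult C c) (\<lambda>c1 c'. sw C C (comult C c') (\<lambda>c2 c3.
         sw H C (\<rho> c2) (\<lambda>x e. sw H H (\<alpha> c3) (\<lambda>a b. sw H H (comult H h) (\<lambda>h1 h2.
           (c1 \<otimes>[C, H] (x * a * h1)) \<otimes>[C \<odot> H, C \<odot> H] (e \<otimes>[C, H] (b * h2))))))))),
     counit = tensor_counit H C,
     act = tensor_act H C\<rparr>"

text \<open>The left \<open>C\<close>-coaction \<open>c \<otimes> h \<mapsto> c\<^sub>1 \<otimes> (c\<^sub>2 \<otimes> h)\<close>, common to all crossed coproducts.\<close>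

definition left_coaction ::
  "('k::field, 'h::ring_1, 'y) hopf_scheme \<Rightarrow> ('k, 'c::ab_group_add, 'z) coalg_scheme \<Rightarrow>
    ('k, 'c, 'h) tensor \<Rightarrow> ('k, 'c, ('k, 'c, 'h) tensor) tensor" where
  "left_coaction H C t = sw C H t (\<lambda>c h. sw C C (comult C c) (\<lambda>c1 c2.
     c1 \<otimes>[C, C \<odot> H] (c2 \<otimes>[C, H] h)))"

definition left_colinear ::
  "('k::field, 'h::ring_1, 'y) hopf_scheme \<Rightarrow> ('k, 'c::ab_group_add, 'z) coalg_scheme \<Rightarrow>
    (('k, 'c, 'h) tensor \<Rightarrow> ('k, 'c, 'h) tensor) \<Rightarrow> bool" where
  "left_colinear H C f \<longleftrightarrow>
    (\<forall>t\<in>carr (C \<odot> H). left_coaction H C (f t) =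
      sw C (C \<odot> H) (left_coaction H C t) (\<lambda>c s. c \<otimes>[C, C \<odot> H] f s))"

definition right_linear ::
  "('k::field, 'h, 'd, 'y) mcoalg_scheme \<Rightarrow> ('k, 'h, 'e, 'z) mcoalg_scheme \<Rightarrow>
    ('d \<Rightarrow> 'e) \<Rightarrow> bool" where
  "right_linear D E f \<longleftrightarrow> (\<forall>d\<in>carr D. \<forall>h. f (act D d h) = act E (f d) h)"

definition corresponding_coaction ::
  "('k::field, 'h::ring_1, 'y) hopf_scheme \<Rightarrow> ('k, 'c::ab_group_add, 'z) coalg_scheme \<Rightarrow>
    (('k, 'c, 'h) tensor \<Rightarrow> ('k, 'h, ('k, 'c, 'h) tensor) tensor) \<Rightarrow>
    'c \<Rightarrow> ('k, 'h, 'c) tensor" where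
  "corresponding_coaction H C \<tau> c =
    sw H (C \<odot> H) (\<tau> (c \<otimes>[C, H] 1)) (\<lambda>x t. sw C H t (\<lambda>e h. x \<otimes>[H, C] scl C (counit H h) e))"

definition corresponding_cocycle ::
  "('k::field, 'h::ring_1, 'y) hopf_scheme \<Rightarrow> ('k, 'c::ab_group_add, 'z) coalg_scheme \<Rightarrow>
    (('k, 'c, 'h) tensor \<Rightarrow> ('k, 'h, ('k, 'c, 'h) tensor) tensor) \<Rightarrow>
    'c \<Rightarrow> ('k, 'h, 'h) tensor" where
  "corresponding_cocycle H C \<tau> c =
    sw H (C \<odot> H) (\<tau> (c \<otimes>[C, H] 1)) (\<lambda>x t. sw C H t (\<lambda>e h. x \<otimes>[H, H] scl H (counit C e) h))"

text \<open>\<open>(\<rho>, \<alpha>)\<close> are the data of the crossed coproduct corresponding to the twisting \<open>\<tau>\<close>.\<close>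

definition corresponds ::
  "('k::field, 'h::ring_1, 'y) hopf_scheme \<Rightarrow> ('k, 'c::ab_group_add, 'z) coalg_scheme \<Rightarrow>
    (('k, 'c, 'h) tensor \<Rightarrow> ('k, 'h, ('k, 'c, 'h) tensor) tensor) \<Rightarrow>
    ('c \<Rightarrow> ('k, 'h, 'c) tensor) \<Rightarrow> ('c \<Rightarrow> ('k, 'h, 'h) tensor) \<Rightarrow> bool" where
  "corresponds H C \<tau> \<rho> \<alpha> \<longleftrightarrow>
    weak_coaction H C \<rho> \<and> harrison_cocycle H C \<rho> \<alpha> \<and>
    (\<forall>c\<in>carr C. \<rho> c = corresponding_coaction H C \<tau> c) \<and>
    (\<forall>c\<in>carr C. \<alpha> c = corresponding_cocycle H C \<tau> c)"


section \<open>Universal property of the tensor product\<close>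

lemma vector_space_fun: "vector_space (\<lambda>(a::'k::field) (T :: 'b \<Rightarrow> 'k) \<beta>. a * T \<beta>)"
  by unfold_locales (auto simp: fun_eq_iff algebra_simps)

lemma vspace_tensor:
  fixes V :: "('k::field, 'v::ab_group_add, 'y) vs_scheme"
    and W :: "('k, 'w::ab_group_add, 'z) vs_scheme"
  shows "vspace (V \<odot> W)"
proof -
  interpret vector_space "\<lambda>(a::'k) (T :: ('k, 'v, 'w) tensor) \<beta>. a * T \<beta>"
    by (rule vector_space_fun)
  show ?thesis
    using vector_space_fun by (simp add: vspace_def tensor_space_def)
qed

lemma tensor_representation:
  fixes V :: "('k::field, 'v::ab_group_add, 'y) vs_scheme"
    and W :: "('k, 'w::ab_group_add, 'z) vs_scheme"
  assumes V: "vspace V"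
  shows "T \<in> carr (V \<odot> W) \<longleftrightarrow>
    (\<exists>xs. set xs \<subseteq> carr V \<times> carr W \<and> T = (\<Sum>(x, y)\<leftarrow>xs. x \<otimes>[V, W] y))"
proof -
  interpret t: vector_space "\<lambda>(a::'k) (T :: ('k, 'v, 'w) tensor) \<beta>. a * T \<beta>"
    by (rule vector_space_fun)
  interpret v: vector_space "scl V" using V by (simp add: vspace_def)
  let ?P = "{x \<otimes>[V, W] y |x y. x \<in> carr V \<and> y \<in> carr W}"
  have "\<exists>xs. set xs \<subseteq> carr V \<times> carr W \<and> T = (\<Sum>(x, y)\<leftarrow>xs. x \<otimes>[V, W] y)"
    if "T \<in> t.span ?P"
    using that
  proof (induction rule: t.span_induct_alt)
    case base
    show ?case by (intro exI[of _ "[]"]) simp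
  next
    case (step a p T)
    then obtain x y xs where p: "p = x \<otimes>[V, W] y" "x \<in> carr V" "y \<in> carr W"
      and xs: "set xs \<subseteq> carr V \<times> carr W" "T = (\<Sum>(x, y)\<leftarrow>xs. x \<otimes>[V, W] y)" by blast
    have ax: "scl V a x \<in> carr V"
      using V p(2) by (auto simp: vspace_def intro: v.subspace_scale)
    have "(\<lambda>\<beta>. a * p \<beta>) = scl V a x \<otimes>[V, W] y"
      using p by (auto simp: pure_tensor_def fun_eq_iff kbilinear_def klinear_def ground_def)
    with ax p xs show ?case by (intro exI[of _ "(scl V a x, y) # xs"]) simp
  qed
  moreover have "(\<Sum>(x, y)\<leftarrow>xs. x \<otimes>[V, W] y) \<in> t.span ?P" if "set xs \<subseteq> carr V \<times> carr W" for xs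
    using that
  proof (induction xs)
    case Nil
    show ?case using t.span_zero[of ?P] by (simp add: zero_fun_def)
  next
    case (Cons p xs)
    then have "case_prod (\<lambda>x y. x \<otimes>[V, W] y) p \<in> t.span ?P" by (auto intro!: t.span_base)
    with Cons show ?case
      unfolding list.map sum_list.Cons by (intro t.span_add) auto
  qed
  ultimately show ?thesis by (auto simp: tensor_space_def)
qed

lemma pure_in_tensor:
  "vspace V \<Longrightarrow> x \<in> carr V \<Longrightarrow> y \<in> carr W \<Longrightarrow> x \<otimes>[V, W] y \<in> carr (V \<odot> W)"
  by (subst tensor_representation) (auto intro!: exI[of _ "[(x, y)]"])

lemma functional_separates:
  assumes "vspace (U :: ('k::field, 'u::ab_group_add, 'z) vs_scheme)" "u \<noteq> 0"
  shows "\<exists>f. (\<forall>x y. f (x + y) = f x + f y) \<and> (\<forall>a x. f (scl U a x) = a * f x) \<and> f u \<noteq> 0"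
proof -
  have *: "vector_space ((*) :: 'k \<Rightarrow> 'k \<Rightarrow> 'k)"
    by unfold_locales (auto simp: algebra_simps)
  interpret vector_space_pair "scl U" "(*) :: 'k \<Rightarrow> 'k \<Rightarrow> 'k"
    using assms * by (simp add: vspace_def vector_space_pair_def)
  obtain g where g: "Vector_Spaces.linear (scl U) (*) g" "g u = 1"
    using linear_independent_extend[of "{u}" "\<lambda>_. 1"] assms(2) by auto
  then show ?thesis
    by (intro exI[of _ g])
      (simp add: linear_add[OF g(1)] linear_scale[OF g(1)])
qed

lemma bilinear_sums_eq:
  fixes b :: "'v::ab_group_add \<Rightarrow> 'w::ab_group_add \<Rightarrow> 'u::ab_group_add"
  assumes b: "kbilinear V W U b" and U: "vspace U"
    and xs: "set xs \<subseteq> carr V \<times> carr W" and ys: "set ys \<subseteq> carr V \<times> carr W"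
    and eq: "(\<Sum>(x, y)\<leftarrow>xs. x \<otimes>[V, W] y) = (\<Sum>(x, y)\<leftarrow>ys. x \<otimes>[V, W] y)"
  shows "(\<Sum>(x, y)\<leftarrow>xs. b x y) = (\<Sum>(x, y)\<leftarrow>ys. b x y)"
proof (rule ccontr)
  assume "\<not> ?thesis"
  then have "(\<Sum>(x, y)\<leftarrow>xs. b x y) - (\<Sum>(x, y)\<leftarrow>ys. b x y) \<noteq> 0" by simp
  from functional_separates[OF U this] obtain f where
    add: "\<And>x y. f (x + y) = f x + f y" and sc: "\<And>a x. f (scl U a x) = a * f x"
    and ne: "f ((\<Sum>(x, y)\<leftarrow>xs. b x y) - (\<Sum>(x, y)\<leftarrow>ys. b x y)) \<noteq> 0" by blast
  define \<beta> where "\<beta> = (\<lambda>x y. f (b x y))"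
  have \<beta>: "kbilinear V W ground \<beta>"
    using b add sc by (simp add: kbilinear_def klinear_def \<beta>_def ground_def)
  have f0: "f 0 = 0" by (metis add add_0 add_cancel_left_left)
  have fsum: "f (\<Sum>(x, y)\<leftarrow>zs. b x y) = (\<Sum>(x, y)\<leftarrow>zs. x \<otimes>[V, W] y) \<beta>" for zs
  proof (induction zs)
    case Nil
    then show ?case by (simp add: f0)
  next
    case (Cons p zs)
    then show ?case by (cases p) (simp add: add pure_tensor_def \<beta>, simp add: \<beta>_def)
  qed
  have "f ((\<Sum>(x, y)\<leftarrow>xs. b x y) - (\<Sum>(x, y)\<leftarrow>ys. b x y)) + f (\<Sum>(x, y)\<leftarrow>ys. b x y) =
    f (\<Sum>(x, y)\<leftarrow>xs. b x y)"
    by (simp add: add[symmetric])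
  with fsum[of xs] fsum[of ys] eq ne show False by simp
qed

lemma sw_eq:
  assumes "kbilinear V W U b" "vspace U" "set xs \<subseteq> carr V \<times> carr W"
  shows "sw V W (\<Sum>(x, y)\<leftarrow>xs. x \<otimes>[V, W] y) b = (\<Sum>(x, y)\<leftarrow>xs. b x y)"
proof -
  let ?P = "\<lambda>ys. set ys \<subseteq> carr V \<times> carr W \<and>
    (\<Sum>(x, y)\<leftarrow>xs. x \<otimes>[V, W] y) = (\<Sum>(x, y)\<leftarrow>ys. x \<otimes>[V, W] y)"
  have "?P (SOME ys. ?P ys)" by (rule someI[of ?P xs]) (use assms in simp)
  then show ?thesis
    unfolding sw_def Let_def by (intro bilinear_sums_eq[OF assms(1,2)] assms(3)) auto
qed

lemma sw_pure:
  assumes "kbilinear V W U b" "vspace U" "x \<in> carr V" "y \<in> carr W"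
  shows "sw V W (x \<otimes>[V, W] y) b = b x y"
  using sw_eq[OF assms(1,2), of "[(x, y)]"] assms(3,4) by simp

end

theory Submission
  imports Defs
begin

text \<open>
  Put \<open>D = C \<otimes> H\<close>. A map \<open>v : D \<rightarrow> H\<close> with \<open>v(d\<cdot>h) = S(h\<^sub>1) v(d) h\<^sub>2\<close> defines the right \<open>H\<close>-linear
  map \<open>\<Phi>(d) = d\<^sub>1\<cdot>v(d\<^sub>2)\<close> (\<open>gauge\<close>, \<open>gauge_act\<close>). The comultiplication of a twisted coalgebra has the
  form \<open>d \<mapsto> d\<^sub>1\<cdot>X(d\<^sub>2)\<close> with \<open>X : D \<rightarrow> H \<otimes> D\<close> (\<open>twisted_comult\<close>), and this form is what makes
  the two notions comparable: if \<open>X\<close> and \<open>Y\<close> denote the left and the right side of the equation by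
  which \<open>v\<close> relates \<open>\<tau>'\<close> and \<open>\<tau>\<close> in the definition of equivalence, then
  \<open>\<Delta>\<^sub>\<tau>\<^sub>'(\<Phi> d) = d\<^sub>1\<cdot>X(d\<^sub>2)\<close> and \<open>(\<Phi> \<otimes> \<Phi>)(\<Delta>\<^sub>\<tau> d) = d\<^sub>1\<cdot>Y(d\<^sub>2)\<close>
  (\<open>twisted_comult_gauge\<close>, \<open>sw_twisted_comult_gauge\<close>). Thus \<open>X = Y\<close> implies that \<open>\<Phi>\<close> respects the
  comultiplications. On \<open>C \<otimes> H\<close> the converse holds too, because \<open>X\<close> can be recovered from
  \<open>d \<mapsto> d\<^sub>1\<cdot>X(d\<^sub>2)\<close>: apply \<open>\<epsilon>\<^sub>C\<close> to the first leg and remove the remaining factor from \<open>H\<close> with the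
  antipode (\<open>twisted_comult_cancel\<close>).

  It remains to match the maps \<open>v\<close> with the maps \<open>\<Phi>\<close>. A left \<open>C\<close>-colinear, right \<open>H\<close>-linear
  endomorphism of \<open>C \<otimes> H\<close> is the same as a linear map \<open>u : C \<rightarrow> H\<close>, by
  \<open>c \<otimes> h \<mapsto> c\<^sub>1 \<otimes> u(c\<^sub>2)h\<close> (\<open>colinear_map_characterization\<close>), and composition corresponds to
  convolution (\<open>colinear_map_convolution\<close>); hence the bijective ones are those with \<open>u\<close> convolution
  invertible. On the other side \<open>v\<close> is determined by \<open>u(c) = v(c \<otimes> 1)\<close>, and every \<open>u\<close> extends to
  \<open>v(c \<otimes> h) = S(h\<^sub>1) u(c) h\<^sub>2\<close>, for which \<open>d\<^sub>1\<cdot>v(d\<^sub>2)\<close> is the colinear map of \<open>u\<close>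
  (\<open>gauge_equivariant_extension\<close>). Under this correspondence \<open>\<epsilon>\<^sub>H \<circ> v = \<epsilon>\<^sub>D\<close> says that \<open>\<Phi>\<close> preserves
  counits.

  The crossed coproducts enter through the identity \<open>\<Delta>\<^sub>\<alpha> = \<Delta>\<^sub>\<tau>\<close> (\<open>comult_crossed_coproduct\<close>), which
  says that \<open>\<tau>(c \<otimes> 1)\<close> is the product of \<open>\<rho>(c\<^sub>1)\<close> and \<open>\<alpha>(c\<^sub>2)\<close>. This factorization is the image of
  the coassociativity of \<open>\<Delta>\<^sub>\<tau>\<close> under counits applied to three of the six tensor factors
  (\<open>tau_factors\<close>).
\<close>

section \<open>Linear maps and Sweedler sums\<close>

lemma vspace_zero: "vspace V \<Longrightarrow> 0 \<in> carr V"
  unfolding vspace_def by (metis module_iff_vector_space module.subspace_0)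

lemma vspace_add: "vspace V \<Longrightarrow> x \<in> carr V \<Longrightarrow> y \<in> carr V \<Longrightarrow> x + y \<in> carr V"
  unfolding vspace_def by (metis module_iff_vector_space module.subspace_add)

lemma vspace_scl: "vspace V \<Longrightarrow> x \<in> carr V \<Longrightarrow> scl V a x \<in> carr V"
  unfolding vspace_def by (metis module_iff_vector_space module.subspace_scale)

lemma vspace_scl_distribs:
  assumes "vspace V"
  shows "scl V (a + b) x = scl V a x + scl V b x" "scl V a (x + y) = scl V a x + scl V a y"
    "scl V a (scl V b x) = scl V (a * b) x" "scl V 1 x = x"
proof -
  interpret vector_space "scl V" using assms by (simp add: vspace_def)
  show "scl V (a + b) x = scl V a x + scl V b x" "scl V a (x + y) = scl V a x + scl V a y"
    "scl V a (scl V b x) = scl V (a * b) x" "scl V 1 x = x"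
    by (simp_all add: scale_left_distrib scale_right_distrib)
qed

lemma vspace_sum_list:
  "vspace V \<Longrightarrow> (\<And>p. p \<in> set xs \<Longrightarrow> f p \<in> carr V) \<Longrightarrow> (\<Sum>p\<leftarrow>xs. f p) \<in> carr V"
  by (induction xs) (auto intro: vspace_zero vspace_add)

lemma vspace_ground: "vspace ground"
proof -
  interpret vector_space "(*) :: 'a \<Rightarrow> 'a \<Rightarrow> 'a"
    by unfold_locales (auto simp: algebra_simps)
  show ?thesis
    by (simp add: vspace_def ground_def vector_space_axioms)
qed

lemma klinearI:
  assumes "\<And>x. x \<in> carr V \<Longrightarrow> f x \<in> carr W"
    "\<And>x y. x \<in> carr V \<Longrightarrow> y \<in> carr V \<Longrightarrow> f (x + y) = f x + f y"
    "\<And>a x. x \<in> carr V \<Longrightarrow> f (scl V a x) = scl W a (f x)"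
  shows "klinear V W f"
  using assms by (simp add: klinear_def)

lemma klinear_in: "klinear V W f \<Longrightarrow> x \<in> carr V \<Longrightarrow> f x \<in> carr W"
  and klinear_add: "klinear V W f \<Longrightarrow> x \<in> carr V \<Longrightarrow> y \<in> carr V \<Longrightarrow> f (x + y) = f x + f y"
  and klinear_scl: "klinear V W f \<Longrightarrow> x \<in> carr V \<Longrightarrow> f (scl V a x) = scl W a (f x)"
  by (simp_all add: klinear_def)

lemma klinear_sum_list:
  assumes "vspace V" "klinear V W f" "\<And>p. p \<in> set xs \<Longrightarrow> g p \<in> carr V"
  shows "f (\<Sum>p\<leftarrow>xs. g p) = (\<Sum>p\<leftarrow>xs. f (g p))"
proof -
  have "f 0 = 0"
    using klinear_add[OF assms(2), of 0 0] vspace_zero[OF assms(1)] by simp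
  then show ?thesis
    using assms(3) by (induction xs) (auto simp: klinear_add[OF assms(2)] vspace_sum_list[OF assms(1)])
qed

lemma klinear_id: "klinear V V (\<lambda>x. x)"
  by (simp add: klinear_def)

lemma klinear_comp: "klinear W U f \<Longrightarrow> klinear V W g \<Longrightarrow> klinear V U (\<lambda>x. f (g x))"
  by (simp add: klinear_def)

lemma kbilinear_left: "kbilinear V W U b \<Longrightarrow> klinear X V g \<Longrightarrow> y \<in> carr W \<Longrightarrow> klinear X U (\<lambda>x. b (g x) y)"
  by (auto simp: kbilinear_def klinear_def)

lemma kbilinear_right: "kbilinear V W U b \<Longrightarrow> x \<in> carr V \<Longrightarrow> klinear X W g \<Longrightarrow> klinear X U (\<lambda>y. b x (g y))"
  by (auto simp: kbilinear_def klinear_def)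

lemma kbilinear_in: "kbilinear V W U b \<Longrightarrow> x \<in> carr V \<Longrightarrow> y \<in> carr W \<Longrightarrow> b x y \<in> carr U"
  by (auto simp: kbilinear_def klinear_def)

lemma kbilinear_pure: "vspace V \<Longrightarrow> vspace W \<Longrightarrow> kbilinear V W (V \<odot> W) (\<lambda>x y. x \<otimes>[V, W] y)"
  by (auto simp: kbilinear_def klinear_def pure_in_tensor)
    (auto simp: pure_tensor_def fun_eq_iff tensor_space_def kbilinear_def klinear_def ground_def)

lemma kbilinear_scl: "vspace V \<Longrightarrow> kbilinear ground V V (scl V)"
  by (auto simp: kbilinear_def klinear_def vspace_scl vspace_scl_distribs ground_def mult.commute)

text \<open>
  The list over which a Sweedler sum runs depends on the tensor only. Nested sums over two tensors are
  thus ordinary double sums and can be interchanged, and a linear map can be applied term by term.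
  Bilinearity of the summand enters when the tensor itself is rewritten.
\<close>

definition sweedler_list ::
  "('k::field, 'v::ab_group_add, 'y) vs_scheme \<Rightarrow> ('k, 'w::ab_group_add, 'z) vs_scheme \<Rightarrow>
    ('k, 'v, 'w) tensor \<Rightarrow> ('v \<times> 'w) list" where
  "sweedler_list V W T =
    (SOME xs. set xs \<subseteq> carr V \<times> carr W \<and> T = (\<Sum>(x, y)\<leftarrow>xs. x \<otimes>[V, W] y))"

lemma sw_sum_list: "sw V W T b = (\<Sum>(x, y)\<leftarrow>sweedler_list V W T. b x y)"
  by (simp add: sw_def sweedler_list_def)

lemma sweedler_list:
  assumes "vspace V" "T \<in> carr (V \<odot> W)"
  shows "set (sweedler_list V W T) \<subseteq> carr V \<times> carr W"
    "T = (\<Sum>(x, y)\<leftarrow>sweedler_list V W T. x \<otimes>[V, W] y)"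
  using someI_ex[OF assms(2)[unfolded tensor_representation[OF assms(1)]]]
  by (simp_all add: sweedler_list_def)

text \<open>
  Membership in the tensor product appears as a premise because the chosen list is otherwise
  arbitrary and need not lie in the carriers. With this congruence rule the simplifier knows, under a
  Sweedler sum, that the summation variables are elements of the carriers.
\<close>

lemma sw_cong [cong]:
  assumes "T = T'" "vspace V \<and> T' \<in> carr (V \<odot> W)"
    "\<And>x y. x \<in> carr V \<Longrightarrow> y \<in> carr W \<Longrightarrow> f x y = g x y"
  shows "sw V W T f = sw V W T' g"
  unfolding sw_sum_list assms(1)
  by (rule arg_cong[where f = sum_list], rule map_cong[OF refl])
    (use sweedler_list(1) assms(2,3) in fastforce)

lemma sw_swap:
  "sw V W T (\<lambda>a b. sw V' W' T' (\<lambda>c d. f a b c d)) = sw V' W' T' (\<lambda>c d. sw V W T (\<lambda>a b. f a b c d))"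
proof -
  have "(\<Sum>p\<leftarrow>xs. \<Sum>q\<leftarrow>ys. h p q) = (\<Sum>q\<leftarrow>ys. \<Sum>p\<leftarrow>xs. h p q)" for xs ys and h :: "_ \<Rightarrow> _ \<Rightarrow> 'z::ab_group_add"
    by (induction xs) (simp_all add: sum_list_addf)
  then show ?thesis
    by (simp add: sw_sum_list case_prod_beta')
qed

lemma sw_in:
  assumes "vspace V" "vspace U" "T \<in> carr (V \<odot> W)"
    "\<And>x y. x \<in> carr V \<Longrightarrow> y \<in> carr W \<Longrightarrow> f x y \<in> carr U"
  shows "sw V W T f \<in> carr U"
  unfolding sw_sum_list
  by (rule vspace_sum_list[OF assms(2)]) (use sweedler_list(1)[OF assms(1,3)] assms(4) in auto)

lemma klinear_sw:
  assumes "klinear X U f" "vspace V" "vspace X" "T \<in> carr (V \<odot> W)"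
    "\<And>x y. x \<in> carr V \<Longrightarrow> y \<in> carr W \<Longrightarrow> g x y \<in> carr X"
  shows "f (sw V W T (\<lambda>x y. g x y)) = sw V W T (\<lambda>x y. f (g x y))"
  unfolding sw_sum_list case_prod_beta'
  by (rule klinear_sum_list[OF assms(3,1)]) (use sweedler_list(1)[OF assms(2,4)] assms(5) in auto)

lemma sw_pure_id:
  "vspace V \<Longrightarrow> T \<in> carr (V \<odot> W) \<Longrightarrow> sw V W T (\<lambda>x y. x \<otimes>[V, W] y) = T"
  by (simp add: sw_sum_list sweedler_list(2)[symmetric])

lemma sw_add_scl:
  assumes "vspace V" "vspace U" "kbilinear V W U f"
  shows sw_add: "S \<in> carr (V \<odot> W) \<Longrightarrow> T \<in> carr (V \<odot> W) \<Longrightarrow> sw V W (S + T) f = sw V W S f + sw V W T f"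
    and sw_scl: "T \<in> carr (V \<odot> W) \<Longrightarrow> sw V W (scl (V \<odot> W) a T) f = scl U a (sw V W T f)"
proof -
  assume S: "S \<in> carr (V \<odot> W)" and T: "T \<in> carr (V \<odot> W)"
  note s = sweedler_list[OF assms(1) S] and t = sweedler_list[OF assms(1) T]
  have "S + T = (\<Sum>(x, y)\<leftarrow>sweedler_list V W S @ sweedler_list V W T. x \<otimes>[V, W] y)"
    using s(2) t(2) by simp
  then have "sw V W (S + T) f = (\<Sum>(x, y)\<leftarrow>sweedler_list V W S @ sweedler_list V W T. f x y)"
    using sw_eq[OF assms(3,2), of "sweedler_list V W S @ sweedler_list V W T"] s(1) t(1)
    by (simp only: set_append Un_subset_iff)
  then show "sw V W (S + T) f = sw V W S f + sw V W T f"
    by (simp add: sw_sum_list)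
next
  assume T: "T \<in> carr (V \<odot> W)"
  note t = sweedler_list[OF assms(1) T]
  have t1: "fst p \<in> carr V" "snd p \<in> carr W" if "p \<in> set (sweedler_list V W T)" for p
    using t(1) that by auto
  let ?xs = "map (\<lambda>(x, y). (scl V a x, y)) (sweedler_list V W T)"
  have l: "klinear V (V \<odot> W) (\<lambda>x. x \<otimes>[V, W] y)" if "y \<in> carr W" for y
    using that assms(1)
    by (auto simp: klinear_def pure_in_tensor)
      (auto simp: pure_tensor_def fun_eq_iff tensor_space_def kbilinear_def klinear_def ground_def)
  have l2: "klinear V U (\<lambda>x. f x y)" if "y \<in> carr W" for y
    using that assms(3) by (simp add: kbilinear_def)
  have "klinear (V \<odot> W) (V \<odot> W) (scl (V \<odot> W) a)"
    using vspace_tensor[of V W]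
    by (auto simp: klinear_def vspace_scl vspace_scl_distribs mult.commute)
  from klinear_sum_list[OF vspace_tensor this, of "sweedler_list V W T" "\<lambda>(x, y). x \<otimes>[V, W] y"]
  have "scl (V \<odot> W) a T = (\<Sum>(x, y)\<leftarrow>sweedler_list V W T. scl (V \<odot> W) a (x \<otimes>[V, W] y))"
    using t assms(1) by (auto simp: pure_in_tensor case_prod_beta' subset_iff)
  also have "\<dots> = (\<Sum>(x, y)\<leftarrow>?xs. x \<otimes>[V, W] y)"
    by (simp add: case_prod_beta' comp_def klinear_scl[OF l] t1 cong: map_cong)
  finally have eq: "scl (V \<odot> W) a T = (\<Sum>(x, y)\<leftarrow>?xs. x \<otimes>[V, W] y)" .
  have "set ?xs \<subseteq> carr V \<times> carr W"
    using t(1) vspace_scl[OF assms(1)] by auto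
  from sw_eq[OF assms(3,2) this]
  have "sw V W (scl (V \<odot> W) a T) f = (\<Sum>(x, y)\<leftarrow>?xs. f x y)" unfolding eq .
  also have "\<dots> = (\<Sum>(x, y)\<leftarrow>sweedler_list V W T. scl U a (f x y))"
    by (simp add: case_prod_beta' comp_def klinear_scl[OF l2] t1 cong: map_cong)
  also have "\<dots> = scl U a (sw V W T f)"
  proof -
    have "klinear U U (scl U a)"
      using assms(2) by (auto simp: klinear_def vspace_scl vspace_scl_distribs mult.commute)
    from klinear_sum_list[OF assms(2) this, of "sweedler_list V W T" "\<lambda>(x, y). f x y"]
    show ?thesis
      using kbilinear_in[OF assms(3)] t1 by (simp add: sw_sum_list case_prod_beta')
  qed
  finally show "sw V W (scl (V \<odot> W) a T) f = scl U a (sw V W T f)" .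
qed

lemma klinear_sw_tensor:
  assumes "vspace V" "vspace U" "kbilinear V W U f" "klinear X (V \<odot> W) t"
  shows "klinear X U (\<lambda>x. sw V W (t x) f)"
  by (intro klinearI sw_in[OF assms(1,2)])
    (auto simp: klinear_in[OF assms(4)] klinear_add[OF assms(4)] klinear_scl[OF assms(4)]
      sw_add[OF assms(1-3)] sw_scl[OF assms(1-3)] kbilinear_in[OF assms(3)]
      vspace_add vspace_scl vspace_tensor assms(1))

lemma klinear_sw_param:
  assumes "vspace V" "vspace U" "T \<in> carr (V \<odot> W)"
    "\<And>a b. a \<in> carr V \<Longrightarrow> b \<in> carr W \<Longrightarrow> klinear X U (\<lambda>x. f x a b)"
  shows "klinear X U (\<lambda>x. sw V W T (\<lambda>a b. f x a b))"
proof (rule klinearI)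
  show "sw V W T (\<lambda>a b. f x a b) \<in> carr U" if "x \<in> carr X" for x
    using assms that by (intro sw_in) (auto intro: klinear_in[OF assms(4)])
  show "sw V W T (\<lambda>a b. f (x + y) a b) = sw V W T (\<lambda>a b. f x a b) + sw V W T (\<lambda>a b. f y a b)"
    if "x \<in> carr X" "y \<in> carr X" for x y
  proof -
    have "sw V W T (\<lambda>a b. f (x + y) a b) = sw V W T (\<lambda>a b. f x a b + f y a b)"
      using assms that by (intro sw_cong) (auto simp: klinear_add[OF assms(4)])
    then show ?thesis
      by (simp add: sw_sum_list case_prod_beta' sum_list_addf)
  qed
  show "sw V W T (\<lambda>a b. f (scl X r x) a b) = scl U r (sw V W T (\<lambda>a b. f x a b))"
    if "x \<in> carr X" for r x
  proof -
    have "sw V W T (\<lambda>a b. f (scl X r x) a b) = sw V W T (\<lambda>a b. scl U r (f x a b))"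
      using assms that by (intro sw_cong) (auto simp: klinear_scl[OF assms(4)])
    also have "\<dots> = scl U r (sw V W T (\<lambda>a b. f x a b))"
      by (rule klinear_sw[symmetric, where X = U and U = U])
        (use assms that in \<open>auto simp: klinear_def vspace_scl vspace_scl_distribs mult.commute\<close>)
    finally show ?thesis .
  qed
qed

text \<open>
  Nested tensors: the linear map induced by \<open>f\<close> moves into the sum that represents the inner tensor.
\<close>

lemma sw_sw:
  assumes "vspace V" "vspace W" "vspace V'" "vspace U" "T \<in> carr (V \<odot> W)" "kbilinear V' W' U f"
    "\<And>x y. x \<in> carr V \<Longrightarrow> y \<in> carr W \<Longrightarrow> g x y \<in> carr (V' \<odot> W')"
  shows "sw V' W' (sw V W T (\<lambda>x y. g x y)) f = sw V W T (\<lambda>x y. sw V' W' (g x y) f)"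
  by (rule klinear_sw[where f = "\<lambda>T. sw V' W' T f" and X = "V' \<odot> W'" and U = U])
    (use assms in \<open>auto intro: klinear_sw_tensor klinear_id vspace_tensor\<close>)

definition ktrilinear ::
  "('k::field, 'v1::ab_group_add, 'x) vs_scheme \<Rightarrow> ('k, 'v2::ab_group_add, 'y) vs_scheme \<Rightarrow>
    ('k, 'v3::ab_group_add, 'z) vs_scheme \<Rightarrow> ('k, 'u::ab_group_add, 'w) vs_scheme \<Rightarrow>
    ('v1 \<Rightarrow> 'v2 \<Rightarrow> 'v3 \<Rightarrow> 'u) \<Rightarrow> bool" where
  "ktrilinear V1 V2 V3 U f \<longleftrightarrow> (\<forall>x\<in>carr V1. kbilinear V2 V3 U (f x)) \<and>
     (\<forall>y\<in>carr V2. \<forall>z\<in>carr V3. klinear V1 U (\<lambda>x. f x y z))"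

text \<open>Only the vector space underlying a structure enters its tensor products.\<close>

lemma klinear_dom_cong: "carr V = carr V' \<Longrightarrow> scl V = scl V' \<Longrightarrow> klinear V U = klinear V' U"
  and klinear_ran_cong: "carr V = carr V' \<Longrightarrow> scl V = scl V' \<Longrightarrow> klinear U V = klinear U V'"
  by (simp_all add: klinear_def fun_eq_iff)

lemma vspace_cong: "carr V = carr V' \<Longrightarrow> scl V = scl V' \<Longrightarrow> vspace V = vspace V'"
  by (simp add: vspace_def)

lemma kbilinear_left_cong:
    "carr V = carr V' \<Longrightarrow> scl V = scl V' \<Longrightarrow> kbilinear V W U = kbilinear V' W U"
  and kbilinear_right_cong:
    "carr V = carr V' \<Longrightarrow> scl V = scl V' \<Longrightarrow> kbilinear W V U = kbilinear W V' U"
  and kbilinear_ran_cong: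
    "carr V = carr V' \<Longrightarrow> scl V = scl V' \<Longrightarrow> kbilinear U W V = kbilinear U W V'"
  by (simp_all add: kbilinear_def klinear_def fun_eq_iff)

lemma pure_left_cong:
    "carr V = carr V' \<Longrightarrow> scl V = scl V' \<Longrightarrow> x \<otimes>[V, W] y = x \<otimes>[V', W] y"
  and pure_right_cong:
    "carr V = carr V' \<Longrightarrow> scl V = scl V' \<Longrightarrow> y \<otimes>[W, V] x = y \<otimes>[W, V'] x"
  by (simp_all add: pure_tensor_def kbilinear_left_cong[of V V'] kbilinear_right_cong[of V V'])

lemma tensor_left_cong: "carr V = carr V' \<Longrightarrow> scl V = scl V' \<Longrightarrow> V \<odot> W = V' \<odot> W"
  and tensor_right_cong: "carr V = carr V' \<Longrightarrow> scl V = scl V' \<Longrightarrow> W \<odot> V = W \<odot> V'"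
  by (simp_all add: tensor_space_def pure_left_cong[of V V'] pure_right_cong[of V V'])

lemma sw_left_cong: "carr V = carr V' \<Longrightarrow> scl V = scl V' \<Longrightarrow> sw V W T f = sw V' W T f"
  and sw_right_cong: "carr V = carr V' \<Longrightarrow> scl V = scl V' \<Longrightarrow> sw W V T' f' = sw W V' T' f'"
  by (simp_all add: sw_def pure_left_cong[of V V'] pure_right_cong[of V V'])

section \<open>Linearity by simplification\<close>

text \<open>
  A linearity rule treats one operation and one argument position: it reduces linearity of
  \<open>\<lambda>x. b (g x) y\<close> to linearity of \<open>g\<close>. Multilinearity is tested one variable at a time, so the
  simplifier discharges the linearity premises of the Sweedler rules by following the term structure.
\<close>

declare vspace_tensor [simp] vspace_ground [simp] pure_in_tensor [simp] vspace_scl [simp]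
  klinear_id [simp] klinear_sw_tensor [simp] klinear_sw_param [simp] sw_in [simp] sw_pure_id [simp]

lemma carr_ground [simp]: "carr ground = UNIV"
  and scl_ground [simp]: "scl ground a x = a * x"
  by (simp_all add: ground_def)

lemma kbilinear_iff [simp]: "kbilinear V W U f \<longleftrightarrow>
    (\<forall>x. x \<in> carr V \<longrightarrow> klinear W U (\<lambda>y. f x y)) \<and> (\<forall>y. y \<in> carr W \<longrightarrow> klinear V U (\<lambda>x. f x y))"
  by (auto simp: kbilinear_def)

lemma ktrilinear_iff [simp]: "ktrilinear V1 V2 V3 U f \<longleftrightarrow>
    (\<forall>x y. x \<in> carr V1 \<longrightarrow> y \<in> carr V2 \<longrightarrow> klinear V3 U (\<lambda>z. f x y z)) \<and>
    (\<forall>x z. x \<in> carr V1 \<longrightarrow> z \<in> carr V3 \<longrightarrow> klinear V2 U (\<lambda>y. f x y z)) \<and>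
    (\<forall>y z. y \<in> carr V2 \<longrightarrow> z \<in> carr V3 \<longrightarrow> klinear V1 U (\<lambda>x. f x y z))"
  by (auto simp: ktrilinear_def)

lemma klinear_pure [simp]:
  assumes "vspace V" "vspace W"
  shows "klinear X V g \<Longrightarrow> y \<in> carr W \<Longrightarrow> klinear X (V \<odot> W) (\<lambda>x. g x \<otimes>[V, W] y)"
    and "x \<in> carr V \<Longrightarrow> klinear X W g' \<Longrightarrow> klinear X (V \<odot> W) (\<lambda>y. x \<otimes>[V, W] g' y)"
  by (rule kbilinear_left[where b = "\<lambda>x y. x \<otimes>[V, W] y", OF kbilinear_pure[OF assms]]; assumption)
    (rule kbilinear_right[where b = "\<lambda>x y. x \<otimes>[V, W] y", OF kbilinear_pure[OF assms]]; assumption)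

lemma klinear_scale [simp]:
  assumes "vspace V"
  shows "klinear X ground g \<Longrightarrow> y \<in> carr V \<Longrightarrow> klinear X V (\<lambda>x. scl V (g x) y)"
    and "klinear X V g' \<Longrightarrow> klinear X V (\<lambda>y. scl V a (g' y))"
  by (rule kbilinear_left[where b = "scl V", OF kbilinear_scl[OF assms]]; assumption)
    (rule kbilinear_right[where b = "scl V", OF kbilinear_scl[OF assms]], simp_all)

lemma sw_pure_left:
  "vspace V \<Longrightarrow> vspace X \<Longrightarrow> vspace Y \<Longrightarrow> T \<in> carr (V \<odot> W) \<Longrightarrow> y \<in> carr Y \<Longrightarrow>
    (\<And>a b. a \<in> carr V \<Longrightarrow> b \<in> carr W \<Longrightarrow> g a b \<in> carr X) \<Longrightarrow>
    sw V W T (\<lambda>a b. g a b) \<otimes>[X, Y] y = sw V W T (\<lambda>a b. g a b \<otimes>[X, Y] y)"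
  by (rule klinear_sw[where f = "\<lambda>x. x \<otimes>[X, Y] y" and X = X and U = "X \<odot> Y"]) simp_all

lemma sw_pure_right:
  "vspace V \<Longrightarrow> vspace X \<Longrightarrow> vspace Y \<Longrightarrow> T \<in> carr (V \<odot> W) \<Longrightarrow> x \<in> carr X \<Longrightarrow>
    (\<And>a b. a \<in> carr V \<Longrightarrow> b \<in> carr W \<Longrightarrow> g a b \<in> carr Y) \<Longrightarrow>
    x \<otimes>[X, Y] sw V W T (\<lambda>a b. g a b) = sw V W T (\<lambda>a b. x \<otimes>[X, Y] g a b)"
  by (rule klinear_sw[where f = "\<lambda>y. x \<otimes>[X, Y] y" and X = Y and U = "X \<odot> Y"]) simp_all

lemma sw_scale:
  "vspace V \<Longrightarrow> vspace X \<Longrightarrow> T \<in> carr (V \<odot> W) \<Longrightarrow>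
    (\<And>a b. a \<in> carr V \<Longrightarrow> b \<in> carr W \<Longrightarrow> g a b \<in> carr X) \<Longrightarrow>
    scl X r (sw V W T (\<lambda>a b. g a b)) = sw V W T (\<lambda>a b. scl X r (g a b))"
  by (rule klinear_sw[where f = "\<lambda>y. scl X r y" and X = X and U = X]) simp_all

lemma pure_scale:
  assumes "vspace V" "vspace W" "x \<in> carr V" "y \<in> carr W"
  shows "scl V a x \<otimes>[V, W] y = scl (V \<odot> W) a (x \<otimes>[V, W] y)"
    and "x \<otimes>[V, W] scl W a y = scl (V \<odot> W) a (x \<otimes>[V, W] y)"
  using klinear_scl[OF klinear_pure(1)[OF assms(1,2) klinear_id assms(4)] assms(3)]
    klinear_scl[OF klinear_pure(2)[OF assms(1-3) klinear_id] assms(4)] by simp_all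

lemma tensor_ext:
  assumes "vspace V" "vspace U" "klinear (V \<odot> W) U f" "klinear (V \<odot> W) U g"
    "\<And>x y. x \<in> carr V \<Longrightarrow> y \<in> carr W \<Longrightarrow> f (x \<otimes>[V, W] y) = g (x \<otimes>[V, W] y)"
    "T \<in> carr (V \<odot> W)"
  shows "f T = g T"
proof -
  have "f (sw V W T (\<lambda>x y. x \<otimes>[V, W] y)) = sw V W T (\<lambda>x y. f (x \<otimes>[V, W] y))"
    by (rule klinear_sw[OF assms(3)]) (use assms in simp_all)
  also have "\<dots> = sw V W T (\<lambda>x y. g (x \<otimes>[V, W] y))"
    by (rule sw_cong) (use assms in simp_all)
  also have "\<dots> = g (sw V W T (\<lambda>x y. x \<otimes>[V, W] y))"
    by (rule klinear_sw[OF assms(4), symmetric]) (use assms in simp_all)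
  finally show ?thesis using assms by simp
qed

section \<open>Coalgebras\<close>

lemma coalgebra_vspace [simp]: "coalgebra D \<Longrightarrow> vspace D"
  unfolding coalgebra_def by blast

lemma klinear_comult [simp]:
  "coalgebra D \<Longrightarrow> klinear X D g \<Longrightarrow> klinear X (D \<odot> D) (\<lambda>x. comult D (g x))"
  by (rule klinear_comp[where W = D]) (auto simp only: coalgebra_def)

lemma klinear_counit [simp]:
  "coalgebra D \<Longrightarrow> klinear X D g \<Longrightarrow> klinear X ground (\<lambda>x. counit D (g x))"
  by (rule klinear_comp[where W = D]) (auto simp only: coalgebra_def)

lemma comult_in [simp]: "coalgebra D \<Longrightarrow> d \<in> carr D \<Longrightarrow> comult D d \<in> carr (D \<odot> D)"
  unfolding coalgebra_def klinear_def by blast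

lemma comult_linear [simp]: "coalgebra D \<Longrightarrow> klinear D (D \<odot> D) (comult D)"
  and counit_linear [simp]: "coalgebra D \<Longrightarrow> klinear D ground (counit D)"
  unfolding coalgebra_def by blast+

text \<open>
  The coassociativity axiom, with the linear map \<open>D \<otimes> (D \<otimes> D) \<rightarrow> U\<close> induced by \<open>f\<close> applied to both
  sides. The rules for counits arise from their axioms in the same way.
\<close>

lemma sw_coassoc:
  assumes D: "coalgebra D" and U: "vspace U" and d: "d \<in> carr D" and f: "ktrilinear D D D U f"
  shows "sw D D (comult D d) (\<lambda>x z. sw D D (comult D x) (\<lambda>x y. f x y z)) =
    sw D D (comult D d) (\<lambda>x y. sw D D (comult D y) (\<lambda>y z. f x y z))"
proof -
  let ?F = "\<lambda>T. sw D (D \<odot> D) T (\<lambda>x t. sw D D t (\<lambda>y z. f x y z))"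
  note s = sw_sw[where V' = D and W' = "D \<odot> D" and U = U and f = "\<lambda>x t. sw D D t (\<lambda>y z. f x y z)"]
    sw_pure[where W = "D \<odot> D" and U = U] sw_pure[where W = D and U = U]
  have "?F (sw D D (comult D d) (\<lambda>d1 d2. sw D D (comult D d1) (\<lambda>x y. x \<otimes>[D, D \<odot> D] (y \<otimes>[D, D] d2)))) =
      ?F (sw D D (comult D d) (\<lambda>d1 d2. sw D D (comult D d2) (\<lambda>x y. d1 \<otimes>[D, D \<odot> D] (x \<otimes>[D, D] y))))"
    using D d unfolding coalgebra_def by (intro arg_cong[where f = ?F]) blast
  then show ?thesis
    using assms by (simp add: s)
qed

lemma sw_counit_left:
  assumes D: "coalgebra D" and U: "vspace U" and d: "d \<in> carr D" and f: "klinear D U f"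
  shows "sw D D (comult D d) (\<lambda>x y. scl U (counit D x) (f y)) = f d"
proof -
  have eq: "sw D D (comult D d) (\<lambda>x y. scl D (counit D x) y) = d"
    using D d unfolding coalgebra_def by blast
  have "f (sw D D (comult D d) (\<lambda>x y. scl D (counit D x) y)) =
      sw D D (comult D d) (\<lambda>x y. f (scl D (counit D x) y))"
    by (rule klinear_sw[OF f]) (use D d in simp_all)
  then show ?thesis
    using assms eq by (simp add: klinear_scl[OF f])
qed

lemma sw_counit_right:
  assumes D: "coalgebra D" and U: "vspace U" and d: "d \<in> carr D" and f: "klinear D U f"
  shows "sw D D (comult D d) (\<lambda>x y. scl U (counit D y) (f x)) = f d"
proof -
  have eq: "sw D D (comult D d) (\<lambda>x y. scl D (counit D y) x) = d"
    using D d unfolding coalgebra_def by blast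
  have "f (sw D D (comult D d) (\<lambda>x y. scl D (counit D y) x)) =
      sw D D (comult D d) (\<lambda>x y. f (scl D (counit D y) x))"
    by (rule klinear_sw[OF f]) (use D d in simp_all)
  then show ?thesis
    using assms eq by (simp add: klinear_scl[OF f])
qed

lemma sw_counit_counit:
  "coalgebra D \<Longrightarrow> d \<in> carr D \<Longrightarrow> sw D D (comult D d) (\<lambda>x y. counit D x * counit D y) = counit D d"
  using sw_counit_left[of D ground d "counit D"] by simp

section \<open>Hopf algebras\<close>

locale hopf =
  fixes H :: "('k::field, 'h::ring_1, 'z) hopf_scheme"
  assumes hopf: "hopf_algebra H"
begin

abbreviation S where "S \<equiv> antipode H"

lemma coalgebra_H [simp]: "coalgebra H"
  and carr_H [simp]: "carr H = UNIV"
  and antipode_linear [simp]: "klinear H H S"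
  and counit_mult [simp]: "counit H (x * y) = counit H x * counit H y"
  and counit_one [simp]: "counit H 1 = 1"
  and antipode_axioms: "sw H H (comult H x) (\<lambda>x1 x2. S x1 * x2) = scl H (counit H x) 1"
    "sw H H (comult H x) (\<lambda>x1 x2. x1 * S x2) = scl H (counit H x) 1"
  and comult_one: "comult H 1 = 1 \<otimes>[H, H] 1"
  using hopf unfolding hopf_algebra_def by blast+

lemma vspace_H [simp]: "vspace H"
  by simp

lemma mult_scale: "scl H a x * y = scl H a (x * y)" "x * scl H a y = scl H a (x * y)"
  using hopf unfolding hopf_algebra_def by metis+

lemma klinear_mult [simp]:
  "klinear X H g \<Longrightarrow> klinear X H (\<lambda>x. g x * y)"
  "klinear X H g \<Longrightarrow> klinear X H (\<lambda>x. y * g x)"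
  by (simp_all add: klinear_def algebra_simps mult_scale)

lemma klinear_mult' [simp]: "klinear H H ((*) y)"
  using klinear_mult(2)[OF klinear_id] by simp

lemma klinear_antipode [simp]: "klinear X H g \<Longrightarrow> klinear X H (\<lambda>x. S (g x))"
  by (rule klinear_comp[OF antipode_linear])

lemma comult_H_in [simp]: "comult H x \<in> carr (H \<odot> H)"
  by simp

lemma sw_mult:
  fixes y :: 'h
  shows "vspace V \<Longrightarrow> T \<in> carr (V \<odot> W) \<Longrightarrow> sw V W T (\<lambda>a b. g a b) * y = sw V W T (\<lambda>a b. g a b * y)"
    "vspace V \<Longrightarrow> T \<in> carr (V \<odot> W) \<Longrightarrow> y * sw V W T (\<lambda>a b. g a b) = sw V W T (\<lambda>a b. y * g a b)"
  by (rule klinear_sw[where f = "\<lambda>x. x * y" and X = H and U = H]; simp)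
    (rule klinear_sw[where f = "\<lambda>x. y * x" and X = H and U = H]; simp)

lemma sw_comult_mult:
  assumes "vspace U" "kbilinear H H U f"
  shows "sw H H (comult H (x * y)) f =
    sw H H (comult H x) (\<lambda>x1 x2. sw H H (comult H y) (\<lambda>y1 y2. f (x1 * y1) (x2 * y2)))"
proof -
  have "comult H (x * y) =
      sw H H (comult H x) (\<lambda>x1 x2. sw H H (comult H y) (\<lambda>y1 y2. (x1 * y1) \<otimes>[H, H] (x2 * y2)))"
    using hopf unfolding hopf_algebra_def by blast
  then show ?thesis
    using assms by (simp add: sw_sw[where U = U] sw_pure[where U = U])
qed

lemma sw_comult_one:
  assumes "vspace U" "kbilinear H H U f"
  shows "sw H H (comult H 1) f = f 1 1"
  using assms by (simp add: comult_one sw_pure[where U = U])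

lemma sw_antipode:
  assumes "vspace U" "klinear H U f"
  shows sw_antipode_left: "sw H H (comult H h) (\<lambda>x y. f (S x * y)) = scl U (counit H h) (f 1)"
    and sw_antipode_right: "sw H H (comult H h) (\<lambda>x y. f (x * S y)) = scl U (counit H h) (f 1)"
proof -
  have "f (sw H H (comult H h) (\<lambda>x y. S x * y)) = sw H H (comult H h) (\<lambda>x y. f (S x * y))"
    by (rule klinear_sw[OF assms(2)]) simp_all
  then show "sw H H (comult H h) (\<lambda>x y. f (S x * y)) = scl U (counit H h) (f 1)"
    by (simp add: antipode_axioms klinear_scl[OF assms(2)])
  have "f (sw H H (comult H h) (\<lambda>x y. x * S y)) = sw H H (comult H h) (\<lambda>x y. f (x * S y))"
    by (rule klinear_sw[OF assms(2)]) simp_all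
  then show "sw H H (comult H h) (\<lambda>x y. f (x * S y)) = scl U (counit H h) (f 1)"
    by (simp add: antipode_axioms klinear_scl[OF assms(2)])
qed

text \<open>
  \<open>S(h\<^sub>1)h\<^sub>2 \<otimes> h\<^sub>3 = 1 \<otimes> h = h\<^sub>1S(h\<^sub>2) \<otimes> h\<^sub>3\<close>, as seen by a bilinear map \<open>f\<close>.
\<close>

lemma sw_antipode_cancel:
  assumes U: "vspace U" and f: "kbilinear H H U f"
  shows sw_antipode_cancel_left:
      "sw H H (comult H h) (\<lambda>h1 h'. sw H H (comult H h') (\<lambda>h2 h3. f (S h1 * h2) h3)) = f 1 h"
    and sw_antipode_cancel_right:
      "sw H H (comult H h) (\<lambda>h1 h'. sw H H (comult H h') (\<lambda>h2 h3. f (h1 * S h2) h3)) = f 1 h"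
proof -
  have l: "klinear H U (\<lambda>x. f x y)" "klinear H U (f y)" for y
    using f by simp_all
  have k: "klinear X U (\<lambda>x. f (g x) y)" "klinear X U (\<lambda>x. f y (g x))" if "klinear X H g" for X :: "('k, 'x::ab_group_add, 'y) vs_scheme" and g y
    using klinear_comp[OF l(1) that] klinear_comp[OF l(2) that] by simp_all
  note s = sw_coassoc[where D = H and U = U, symmetric, OF coalgebra_H U] k
  show "sw H H (comult H h) (\<lambda>h1 h'. sw H H (comult H h') (\<lambda>h2 h3. f (S h1 * h2) h3)) = f 1 h"
    using U by (simp add: s sw_antipode_left[where U = U and f = "\<lambda>x. f x _"] l sw_counit_left)
  show "sw H H (comult H h) (\<lambda>h1 h'. sw H H (comult H h') (\<lambda>h2 h3. f (h1 * S h2) h3)) = f 1 h"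
    using U by (simp add: s sw_antipode_right[where U = U and f = "\<lambda>x. f x _"] l sw_counit_left)
qed

lemma counit_antipode [simp]: "counit H (S h) = counit H h"
proof -
  have "counit H (S h) = sw H H (comult H h) (\<lambda>x y. scl ground (counit H y) (counit H (S x)))"
    by (rule sw_counit_right[symmetric]) simp_all
  also have "\<dots> = sw H H (comult H h) (\<lambda>x y. counit H (S x * y))"
    by (simp add: mult.commute)
  also have "\<dots> = counit H h"
    using sw_antipode_left[where U = ground and f = "counit H" and h = h] by simp
  finally show ?thesis .
qed

text \<open>
  Both \<open>x \<otimes> y \<mapsto> S(xy)\<close> and \<open>x \<otimes> y \<mapsto> S(y)S(x)\<close> are convolution inverse to the multiplication of \<open>H\<close>.
  Correspondingly, in \<open>S(x\<^sub>1y\<^sub>1) x\<^sub>2y\<^sub>2 S(y\<^sub>3)S(x\<^sub>3)\<close> cancelling \<open>x\<^sub>2y\<^sub>2\<close> to the right leaves \<open>S(xy)\<close>, and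
  cancelling it to the left leaves \<open>S(y)S(x)\<close>.
\<close>

lemma antipode_mult: "S (x * y) = S y * S x"
proof -
  let ?f = "\<lambda>x1 x2 x3 y1 y2 y3. S (x1 * y1) * (x2 * y2) * (S y3 * S x3)"
  note s = sw_coassoc[where D = H and U = H, symmetric]
  have "sw H H (comult H x) (\<lambda>x1 x'. sw H H (comult H x') (\<lambda>x2 x3.
      sw H H (comult H y) (\<lambda>y1 y'. sw H H (comult H y') (\<lambda>y2 y3. ?f x1 x2 x3 y1 y2 y3)))) = S (x * y)"
  proof -
    have "sw H H (comult H y') (\<lambda>y2 y3. ?f x1 x2 x3 y1 y2 y3) =
        scl H (counit H y') (S (x1 * y1) * (x2 * S x3))" for x1 x2 x3 y1 y'
      using sw_antipode_right[where U = H and f = "\<lambda>z. S (x1 * y1) * x2 * z * S x3"]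
      by (simp add: mult.assoc)
    then show ?thesis
      using sw_antipode_right[where U = H and f = "\<lambda>z. S (_ * y) * z"]
      by (simp add: sw_counit_right)
  qed
  moreover have "sw H H (comult H x) (\<lambda>x1 x'. sw H H (comult H x') (\<lambda>x2 x3.
      sw H H (comult H y) (\<lambda>y1 y'. sw H H (comult H y') (\<lambda>y2 y3. ?f x1 x2 x3 y1 y2 y3)))) = S y * S x"
  proof -
    have "sw H H (comult H x1) (\<lambda>x1 x2. sw H H (comult H y1) (\<lambda>y1 y2. ?f x1 x2 x3 y1 y2 y3)) =
        scl H (counit H (x1 * y1)) (S y3 * S x3)" for x1 y1 x3 y3
      using sw_antipode_left[where U = H and f = "\<lambda>z. z * (S y3 * S x3)" and h = "x1 * y1"]
      by (simp add: sw_comult_mult[where U = H])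
    moreover have "sw H H (comult H x1) (\<lambda>x1 x2. sw H H (comult H y) (\<lambda>y1 y3. sw H H (comult H y1) (\<lambda>y1 y2. ?f x1 x2 x3 y1 y2 y3)))
      = sw H H (comult H y) (\<lambda>y1 y3. sw H H (comult H x1) (\<lambda>x1 x2. sw H H (comult H y1) (\<lambda>y1 y2. ?f x1 x2 x3 y1 y2 y3)))" for x1 x3
      by (rule sw_swap)
    ultimately show ?thesis
      by (simp add: s sw_counit_left vspace_scl_distribs(3)[symmetric] sw_scale[symmetric])
  qed
  ultimately show ?thesis by simp
qed

end

section \<open>Twisted comultiplications and gauge maps\<close>

text \<open>
  The map \<open>d \<mapsto> d\<^sub>1\<cdot>X(d\<^sub>2)\<close>. For a twisting \<open>X = \<tau>\<close> it is the comultiplication \<open>\<Delta>\<^sub>\<tau>\<close> of \<open>D\<^sup>\<tau>\<close>. Other maps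
  \<open>X\<close> occur because \<open>\<Delta>\<^sub>\<tau> \<circ> \<Phi>\<close> and \<open>(\<Phi> \<otimes> \<Phi>) \<circ> \<Delta>\<^sub>\<tau>\<close> have this form too, where \<open>\<Phi> = gauge D v\<close>.
\<close>

definition twisted_comult ::
  "('k::field, 'h::ring_1, 'y) hopf_scheme \<Rightarrow> ('k, 'h, 'd::ab_group_add, 'z) mcoalg_scheme \<Rightarrow>
    ('d \<Rightarrow> ('k, 'h, 'd) tensor) \<Rightarrow> 'd \<Rightarrow> ('k, 'd, 'd) tensor" where
  "twisted_comult H D X d =
    sw D D (comult D d) (\<lambda>d1 d2. sw H D (X d2) (\<lambda>x e. act D d1 x \<otimes>[D, D] e))"

definition gauge ::
  "('k::field, 'h::ring_1, 'd::ab_group_add, 'z) mcoalg_scheme \<Rightarrow> ('d \<Rightarrow> 'h) \<Rightarrow> 'd \<Rightarrow> 'd" where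
  "gauge D v d = sw D D (comult D d) (\<lambda>d1 d2. act D d1 (v d2))"

text \<open>
  \<open>equiv_left\<close> and \<open>equiv_right\<close> are the two sides of the equation between \<open>v\<close>, \<open>\<tau>'\<close> and \<open>\<tau>\<close> in the
  definition of equivalent twistings.
\<close>

definition equiv_left ::
  "('k::field, 'h::ring_1, 'y) hopf_scheme \<Rightarrow> ('k, 'h, 'd::ab_group_add, 'z) mcoalg_scheme \<Rightarrow>
    ('d \<Rightarrow> 'h) \<Rightarrow> ('d \<Rightarrow> ('k, 'h, 'd) tensor) \<Rightarrow> 'd \<Rightarrow> ('k, 'h, 'd) tensor" where
  "equiv_left H D v \<tau>' d = sw D D (comult D d) (\<lambda>d1 d2. sw H D (\<tau>' d1) (\<lambda>x e.
     sw H H (comult H (v d2)) (\<lambda>p q. (x * p) \<otimes>[H, D] act D e q)))"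

definition equiv_right ::
  "('k::field, 'h::ring_1, 'y) hopf_scheme \<Rightarrow> ('k, 'h, 'd::ab_group_add, 'z) mcoalg_scheme \<Rightarrow>
    ('d \<Rightarrow> 'h) \<Rightarrow> ('d \<Rightarrow> ('k, 'h, 'd) tensor) \<Rightarrow> 'd \<Rightarrow> ('k, 'h, 'd) tensor" where
  "equiv_right H D v \<tau> d = sw D D (comult D d) (\<lambda>d1 d2. sw H D (\<tau> d2) (\<lambda>x e.
     sw D D (comult D e) (\<lambda>e1 e2. (v d1 * x) \<otimes>[H, D] act D e1 (v e2))))"

locale hopf_module_coalgebra = hopf H for H :: "('k::field, 'h::ring_1, 'z) hopf_scheme" +
  fixes D :: "('k, 'h, 'd::ab_group_add, 'y) mcoalg_scheme"
  assumes module_coalgebra: "module_coalgebra H D"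
begin

lemma coalgebra_D [simp]: "coalgebra D"
  and right_module_D: "right_module H D (act D)"
  and counit_act [simp]: "d \<in> carr D \<Longrightarrow> counit D (act D d h) = counit D d * counit H h"
  using module_coalgebra unfolding module_coalgebra_def by blast+

lemma act_bilinear: "kbilinear D H D (act D)"
  and act_one [simp]: "d \<in> carr D \<Longrightarrow> act D d 1 = d"
  and act_act [simp]: "d \<in> carr D \<Longrightarrow> act D (act D d g) h = act D d (g * h)"
  using right_module_D unfolding right_module_def by blast+

lemma klinear_act_left [simp]: "klinear X D g \<Longrightarrow> klinear X D (\<lambda>x. act D (g x) h)"
  by (rule kbilinear_left[OF act_bilinear]) simp_all

lemma klinear_act_right [simp]: "d \<in> carr D \<Longrightarrow> klinear X H g \<Longrightarrow> klinear X D (\<lambda>x. act D d (g x))"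
  by (rule kbilinear_right[OF act_bilinear])

lemma act_in [simp]: "d \<in> carr D \<Longrightarrow> act D d h \<in> carr D"
  by (rule kbilinear_in[OF act_bilinear]) simp_all

lemma sw_act:
  "vspace V \<Longrightarrow> T \<in> carr (V \<odot> W) \<Longrightarrow> (\<And>a b. a \<in> carr V \<Longrightarrow> b \<in> carr W \<Longrightarrow> g a b \<in> carr D) \<Longrightarrow>
    act D (sw V W T (\<lambda>a b. g a b)) h = sw V W T (\<lambda>a b. act D (g a b) h)"
  by (rule klinear_sw[where f = "\<lambda>x. act D x h" and X = D and U = D]) simp_all

lemma sw_act_right:
  assumes "d \<in> carr D"
  shows "vspace V \<Longrightarrow> T \<in> carr (V \<odot> W) \<Longrightarrow>
    act D d (sw V W T (\<lambda>a b. g a b)) = sw V W T (\<lambda>a b. act D d (g a b))"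
  by (rule klinear_sw[where f = "\<lambda>x. act D d x" and X = H and U = D]) (use assms in simp_all)

lemma sw_comult_act:
  assumes "vspace U" "kbilinear D D U f" "d \<in> carr D"
  shows "sw D D (comult D (act D d h)) f =
    sw D D (comult D d) (\<lambda>d1 d2. sw H H (comult H h) (\<lambda>h1 h2. f (act D d1 h1) (act D d2 h2)))"
proof -
  have "comult D (act D d h) =
      sw D D (comult D d) (\<lambda>d1 d2. sw H H (comult H h) (\<lambda>h1 h2. act D d1 h1 \<otimes>[D, D] act D d2 h2))"
    using module_coalgebra assms(3) unfolding module_coalgebra_def by blast
  then show ?thesis
    using assms by (simp add: sw_sw[where U = U] sw_pure[where U = U])
qed

lemma twisted_comult_linear [simp]:
  "klinear D (H \<odot> D) X \<Longrightarrow> klinear D (D \<odot> D) (twisted_comult H D X)"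
  unfolding twisted_comult_def by (simp add: klinear_comp[of D "H \<odot> D" X] klinear_in[of D "H \<odot> D" X])

lemma twisted_comult_act:
  assumes "module_coalgebra H (twist_coalg H D \<tau>)" "d \<in> carr D"
  shows "twisted_comult H D \<tau> (act D d h) =
    sw D D (twisted_comult H D \<tau> d) (\<lambda>p q. sw H H (comult H h) (\<lambda>h1 h2. act D p h1 \<otimes>[D, D] act D q h2))"
proof -
  let ?E = "twist_coalg H D \<tau>"
  have [simp]: "carr ?E = carr D" "scl ?E = scl D" "comult ?E = twisted_comult H D \<tau>" "act ?E = act D"
    by (auto simp: twist_coalg_def twisted_comult_def)
  note c = sw_left_cong[of ?E D] sw_right_cong[of ?E D] pure_left_cong[of ?E D] pure_right_cong[of ?E D]
  have "comult ?E (act ?E d h) = sw ?E ?E (comult ?E d)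
      (\<lambda>d1 d2. sw H H (comult H h) (\<lambda>h1 h2. act ?E d1 h1 \<otimes>[?E, ?E] act ?E d2 h2))"
    using assms unfolding module_coalgebra_def by simp
  then show ?thesis
    by (simp only: \<open>comult ?E = _\<close> \<open>act ?E = _\<close> c[OF \<open>carr ?E = _\<close> \<open>scl ?E = _\<close>])
qed

context
  fixes v
  assumes v: "klinear D H v"
begin

lemma klinear_v [simp]: "klinear X D g \<Longrightarrow> klinear X H (\<lambda>x. v (g x))"
  by (rule klinear_comp[OF v])

lemma gauge_linear [simp]: "klinear D D (gauge D v)"
  unfolding gauge_def by simp

lemma klinear_gauge [simp]: "klinear X D g \<Longrightarrow> klinear X D (\<lambda>x. gauge D v (g x))"
  by (rule klinear_comp[OF gauge_linear])

lemma gauge_in [simp]: "d \<in> carr D \<Longrightarrow> gauge D v d \<in> carr D"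
  by (rule klinear_in[OF gauge_linear])

text \<open>
  Equivariance of \<open>v\<close> is what makes \<open>d \<mapsto> d\<^sub>1\<cdot>v(d\<^sub>2)\<close> right linear:
  \<open>d\<^sub>1\<cdot>h\<^sub>1 S(h\<^sub>2) v(d\<^sub>2) h\<^sub>3 = d\<^sub>1\<cdot>v(d\<^sub>2) h\<close>.
\<close>

lemma gauge_act:
  assumes eq: "\<And>d h. d \<in> carr D \<Longrightarrow>
      v (act D d h) = sw H H (comult H h) (\<lambda>h1 h2. S h1 * v d * h2)"
    and d: "d \<in> carr D"
  shows "gauge D v (act D d h) = act D (gauge D v d) h"
proof -
  have "gauge D v (act D d h) = sw D D (comult D d) (\<lambda>d1 d2. sw H H (comult H h) (\<lambda>h1 h'.
      sw H H (comult H h') (\<lambda>h2 h3. act D d1 (h1 * S h2 * (v d2 * h3)))))"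
    using d by (simp add: gauge_def sw_comult_act[where U = D] eq sw_act_right mult.assoc)
  also have "\<dots> = sw D D (comult D d) (\<lambda>d1 d2. act D d1 (v d2 * h))"
    using d by (simp add: sw_antipode_cancel_right[where U = D and f = "\<lambda>x y. act D _ (x * (v _ * y))"])
  finally show ?thesis
    using d by (simp add: gauge_def sw_act)
qed

context
  fixes \<tau>
  assumes \<tau>: "klinear D (H \<odot> D) \<tau>"
begin

lemma klinear_\<tau> [simp]: "klinear X D g \<Longrightarrow> klinear X (H \<odot> D) (\<lambda>x. \<tau> (g x))"
  by (rule klinear_comp[OF \<tau>])

lemma \<tau>_in [simp]: "d \<in> carr D \<Longrightarrow> \<tau> d \<in> carr (H \<odot> D)"
  by (rule klinear_in[OF \<tau>])

lemma equiv_left_linear [simp]: "klinear D (H \<odot> D) (equiv_left H D v \<tau>)"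
  unfolding equiv_left_def by simp

lemma equiv_right_linear [simp]: "klinear D (H \<odot> D) (equiv_right H D v \<tau>)"
  unfolding equiv_right_def by simp

text \<open>
  Right linearity of \<open>\<Delta>\<^sub>\<tau>\<close> turns \<open>\<Delta>\<^sub>\<tau>(d\<^sub>1\<cdot>v(d\<^sub>2))\<close> into \<open>\<Delta>\<^sub>\<tau>(d\<^sub>1)\<cdot>v(d\<^sub>2)\<close>, and coassociativity of \<open>D\<close> splits
  off the first factor \<open>d\<^sub>1\<close>.
\<close>

lemma twisted_comult_gauge:
  assumes "module_coalgebra H (twist_coalg H D \<tau>)" and d: "d \<in> carr D"
  shows "twisted_comult H D \<tau> (gauge D v d) = twisted_comult H D (equiv_left H D v \<tau>) d"
proof -
  have "twisted_comult H D \<tau> (gauge D v d) =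
      sw D D (comult D d) (\<lambda>d1 d2. twisted_comult H D \<tau> (act D d1 (v d2)))"
    unfolding gauge_def
    by (rule klinear_sw[OF twisted_comult_linear[OF \<tau>]]) (use d in simp_all)
  also have "\<dots> = sw D D (comult D d) (\<lambda>d1 d2. sw D D (comult D d1) (\<lambda>a b. sw H D (\<tau> b) (\<lambda>x e.
      sw H H (comult H (v d2)) (\<lambda>h1 h2. act D a (x * h1) \<otimes>[D, D] act D e h2))))"
    using d by (simp add: twisted_comult_act[OF assms(1)])
      (simp add: twisted_comult_def sw_sw[where U = "D \<odot> D"] sw_pure[where U = "D \<odot> D"])
  also have "\<dots> = sw D D (comult D d) (\<lambda>a d2. sw D D (comult D d2) (\<lambda>b c. sw H D (\<tau> b) (\<lambda>x e.
      sw H H (comult H (v c)) (\<lambda>h1 h2. act D a (x * h1) \<otimes>[D, D] act D e h2))))"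
    by (rule sw_coassoc[where U = "D \<odot> D"]) (use d in simp_all)
  also have "\<dots> = twisted_comult H D (equiv_left H D v \<tau>) d"
    using d by (simp add: twisted_comult_def equiv_left_def sw_sw[where U = "D \<odot> D"] sw_pure[where U = "D \<odot> D"])
  finally show ?thesis .
qed

text \<open>
  The counterpart for \<open>(\<Phi> \<otimes> \<Phi>)\<Delta>\<^sub>\<tau>\<close> with \<open>\<Phi> = gauge D v\<close>: by right linearity
  \<open>\<Phi>(d\<^sub>1\<cdot>x) = \<Phi>(d\<^sub>1)\<cdot>x\<close> for the leg \<open>x\<close> of \<open>\<tau>(d\<^sub>2)\<close> in \<open>H\<close>, so that a first factor \<open>d\<^sub>1\<close> can be split off
  here as well.
\<close>

lemma sw_twisted_comult_gauge:
  assumes eq: "\<And>d h. d \<in> carr D \<Longrightarrow> gauge D v (act D d h) = act D (gauge D v d) h"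
    and d: "d \<in> carr D"
  shows "sw D D (twisted_comult H D \<tau> d) (\<lambda>p q. gauge D v p \<otimes>[D, D] gauge D v q) =
    twisted_comult H D (equiv_right H D v \<tau>) d"
proof -
  have "sw D D (twisted_comult H D \<tau> d) (\<lambda>p q. gauge D v p \<otimes>[D, D] gauge D v q) =
      sw D D (comult D d) (\<lambda>d1 d2. sw H D (\<tau> d2) (\<lambda>x e. act D (gauge D v d1) x \<otimes>[D, D] gauge D v e))"
    using d by (simp add: twisted_comult_def sw_sw[where U = "D \<odot> D"] sw_pure[where U = "D \<odot> D"] eq)
  also have "\<dots> = sw D D (comult D d) (\<lambda>d1 d2. sw H D (\<tau> d2) (\<lambda>x e.
      sw D D (comult D d1) (\<lambda>a b. sw D D (comult D e) (\<lambda>e1 e2.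
        act D a (v b * x) \<otimes>[D, D] act D e1 (v e2)))))"
    using d by (simp add: gauge_def sw_act sw_pure_left) (simp add: sw_pure_right)
  also have "\<dots> = sw D D (comult D d) (\<lambda>d1 d2. sw D D (comult D d1) (\<lambda>a b. sw H D (\<tau> d2) (\<lambda>x e.
      sw D D (comult D e) (\<lambda>e1 e2. act D a (v b * x) \<otimes>[D, D] act D e1 (v e2)))))"
    by (subst sw_swap) simp
  also have "\<dots> = sw D D (comult D d) (\<lambda>a d2. sw D D (comult D d2) (\<lambda>b c. sw H D (\<tau> c) (\<lambda>x e.
      sw D D (comult D e) (\<lambda>e1 e2. act D a (v b * x) \<otimes>[D, D] act D e1 (v e2)))))"
    by (rule sw_coassoc[where U = "D \<odot> D"]) (use d in simp_all)
  also have "\<dots> = twisted_comult H D (equiv_right H D v \<tau>) d"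
    using d by (simp add: twisted_comult_def equiv_right_def sw_sw[where U = "D \<odot> D"] sw_pure[where U = "D \<odot> D"])
  finally show ?thesis .
qed

end

end

end

section \<open>The module coalgebra C \<open>\<otimes>\<close> H\<close>

locale hopf_coalgebra = hopf H for H :: "('k::field, 'h::ring_1, 'z) hopf_scheme" +
  fixes C :: "('k, 'c::ab_group_add, 'y) coalg_scheme"
  assumes coalgebra_C [simp]: "coalgebra C"
begin

abbreviation D where "D \<equiv> tensor_coalg H C"

lemma counit_D: "counit D = (\<lambda>t. sw C H t (\<lambda>c h. counit C c * counit H h))"
  and act_D: "act D = (\<lambda>t g. sw C H t (\<lambda>c h. c \<otimes>[C, H] (h * g)))"
  and comult_raw: "comult D = (\<lambda>t. sw C H t (\<lambda>c h. sw C C (comult C c) (\<lambda>c1 c2.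
      sw H H (comult H h) (\<lambda>h1 h2. (c1 \<otimes>[C, H] h1) \<otimes>[C \<odot> H, C \<odot> H] (c2 \<otimes>[C, H] h2)))))"
  by (auto simp: tensor_coalg_def tensor_counit_def[abs_def] tensor_act_def[abs_def])

text \<open>
  As vector spaces \<open>C \<odot> H\<close> and \<open>D\<close> agree. Everything is normalized to \<open>D\<close>, where the rules for module
  coalgebras apply.
\<close>

lemma tensor_space_D [simp]: "carr (C \<odot> H) = carr D" "scl (C \<odot> H) = scl D"
  by (simp_all add: tensor_coalg_def)

lemma tensor_D [simp]:
  "klinear (C \<odot> H) U = klinear D U" "klinear X (C \<odot> H) = klinear X D"
  "x \<otimes>[C \<odot> H, W] y = x \<otimes>[D, W] y" "y \<otimes>[W, C \<odot> H] x = y \<otimes>[W, D] x"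
  "(C \<odot> H) \<odot> W = D \<odot> W" "W \<odot> (C \<odot> H) = W \<odot> D"
  "sw (C \<odot> H) W T f = sw D W T f" "sw W (C \<odot> H) T' f' = sw W D T' f'"
  by (simp_all add: klinear_dom_cong[of "C \<odot> H" D] klinear_ran_cong[of "C \<odot> H" D]
    pure_left_cong[of "C \<odot> H" D] pure_right_cong[of "C \<odot> H" D]
    tensor_left_cong[of "C \<odot> H" D] tensor_right_cong[of "C \<odot> H" D]
    sw_left_cong[of "C \<odot> H" D] sw_right_cong[of "C \<odot> H" D])

lemma vspace_D [simp]: "vspace D"
  using vspace_cong[of "C \<odot> H" D] by simp

lemma pure_in_D [simp]: "c \<in> carr C \<Longrightarrow> c \<otimes>[C, H] h \<in> carr D"
  using pure_in_tensor[of C c h H] by simp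

lemma klinear_pure_D [simp]:
  "klinear X C g \<Longrightarrow> klinear X D (\<lambda>x. g x \<otimes>[C, H] h)"
  "c \<in> carr C \<Longrightarrow> klinear X H g' \<Longrightarrow> klinear X D (\<lambda>x. c \<otimes>[C, H] g' x)"
  using klinear_pure(1)[of C H X g h] klinear_pure(2)[of C H c X g'] by simp_all

lemma pure_scale_D:
  "c \<in> carr C \<Longrightarrow> scl C a c \<otimes>[C, H] h = scl D a (c \<otimes>[C, H] h)"
  "c \<in> carr C \<Longrightarrow> c \<otimes>[C, H] scl H a h = scl D a (c \<otimes>[C, H] h)"
  using pure_scale[of C H c h a] by simp_all

lemma tensor_ext_D:
  assumes "vspace U" "klinear D U f" "klinear D U g"
    "\<And>c h. c \<in> carr C \<Longrightarrow> f (c \<otimes>[C, H] h) = g (c \<otimes>[C, H] h)" "t \<in> carr D"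
  shows "f t = g t"
  by (rule tensor_ext[where V = C and W = H and U = U and f = f and g = g]) (use assms in simp_all)

lemma comult_D: "comult D = (\<lambda>t. sw C H t (\<lambda>c h. sw C C (comult C c) (\<lambda>c1 c2.
      sw H H (comult H h) (\<lambda>h1 h2. (c1 \<otimes>[C, H] h1) \<otimes>[D, D] (c2 \<otimes>[C, H] h2)))))"
  by (simp only: comult_raw tensor_D)

lemma klinear_ground_mult [simp]:
  "klinear X ground g \<Longrightarrow> klinear X ground (\<lambda>x. g x * (a::'k))"
  "klinear X ground g \<Longrightarrow> klinear X ground (\<lambda>x. (a::'k) * g x)"
  by (simp_all add: klinear_def algebra_simps)

lemma counit_D_linear: "klinear D ground (counit D)"
  and comult_D_linear: "klinear D (D \<odot> D) (comult D)"
  by (simp_all add: counit_D comult_D)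

lemma klinear_comult_D: "klinear X D g \<Longrightarrow> klinear X (D \<odot> D) (\<lambda>x. comult D (g x))"
  by (rule klinear_comp[OF comult_D_linear])

lemma klinear_counit_D: "klinear X D g \<Longrightarrow> klinear X ground (\<lambda>x. counit D (g x))"
  by (rule klinear_comp[OF counit_D_linear])

lemma comult_D_in: "t \<in> carr D \<Longrightarrow> comult D t \<in> carr (D \<odot> D)"
  by (rule klinear_in[OF comult_D_linear])

lemma klinear_tensor_act:
  "klinear X D g \<Longrightarrow> klinear X D (\<lambda>x. act D (g x) h)"
  "t \<in> carr D \<Longrightarrow> klinear X H g' \<Longrightarrow> klinear X D (\<lambda>x. act D t (g' x))"
  by (simp_all add: act_D)

lemma counit_pure [simp]: "c \<in> carr C \<Longrightarrow> counit D (c \<otimes>[C, H] h) = counit C c * counit H h"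
  by (simp add: counit_D sw_pure[where U = ground])

lemma act_pure [simp]: "c \<in> carr C \<Longrightarrow> act D (c \<otimes>[C, H] h) g = c \<otimes>[C, H] (h * g)"
  by (simp add: act_D sw_pure[where U = D])

lemma sw_comult_pure:
  assumes "vspace U" "kbilinear D D U f" "c \<in> carr C"
  shows "sw D D (comult D (c \<otimes>[C, H] h)) f = sw C C (comult C c) (\<lambda>c1 c2.
      sw H H (comult H h) (\<lambda>h1 h2. f (c1 \<otimes>[C, H] h1) (c2 \<otimes>[C, H] h2)))"
  using assms by (simp add: comult_D sw_pure[where U = "D \<odot> D"] sw_sw[where U = U] sw_pure[where U = U])

lemma module_coalgebra_D: "module_coalgebra H D"
proof -
  note l [simp] = klinear_comult_D klinear_counit_D klinear_tensor_act comult_D_in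
  let ?L = "\<lambda>d. sw D D (comult D d) (\<lambda>d1 d2. sw D D (comult D d1) (\<lambda>x y. x \<otimes>[D, D \<odot> D] (y \<otimes>[D, D] d2)))"
  let ?R = "\<lambda>d. sw D D (comult D d) (\<lambda>d1 d2. sw D D (comult D d2) (\<lambda>x y. d1 \<otimes>[D, D \<odot> D] (x \<otimes>[D, D] y)))"
  have coassoc: "?L d = ?R d" if "d \<in> carr D" for d
  proof (rule tensor_ext_D[where t = d and U = "D \<odot> (D \<odot> D)" and f = ?L and g = ?R])
    fix c h assume c: "c \<in> carr C"
    let ?f = "\<lambda>c1 c2 c3 h1 h2 h3. (c1 \<otimes>[C, H] h1) \<otimes>[D, D \<odot> D] ((c2 \<otimes>[C, H] h2) \<otimes>[D, D] (c3 \<otimes>[C, H] h3))"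
    let ?U = "D \<odot> (D \<odot> D)"
    have swap: "sw H H (comult H h) (\<lambda>h1 h2. sw C C (comult C c') (\<lambda>c1 c2. F h1 h2 c1 c2)) =
        sw C C (comult C c') (\<lambda>c1 c2. sw H H (comult H h) (\<lambda>h1 h2. F h1 h2 c1 c2))"
      for c' and F :: "'h \<Rightarrow> 'h \<Rightarrow> 'c \<Rightarrow> 'c \<Rightarrow> _ \<Rightarrow> 'k"
      by (rule sw_swap)
    have "?L (c \<otimes>[C, H] h) =
        sw C C (comult C c) (\<lambda>c' c3. sw H H (comult H h) (\<lambda>h' h3. sw C C (comult C c') (\<lambda>c1 c2.
          sw H H (comult H h') (\<lambda>h1 h2. ?f c1 c2 c3 h1 h2 h3))))"
      using c by (simp add: sw_comult_pure[where U = ?U])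
    \<comment> \<open>separate the factors from \<open>C\<close> and \<open>H\<close>, to use coassociativity of each\<close>
    also have "\<dots> = sw C C (comult C c) (\<lambda>c' c3. sw C C (comult C c') (\<lambda>c1 c2. sw H H (comult H h) (\<lambda>h' h3.
          sw H H (comult H h') (\<lambda>h1 h2. ?f c1 c2 c3 h1 h2 h3))))"
      using c by (simp add: swap)
    also have "\<dots> = sw C C (comult C c) (\<lambda>c1 c'. sw C C (comult C c') (\<lambda>c2 c3. sw H H (comult H h) (\<lambda>h1 h'.
          sw H H (comult H h') (\<lambda>h2 h3. ?f c1 c2 c3 h1 h2 h3))))"
      using c by (simp add: sw_coassoc[where U = ?U])
    also have "\<dots> = sw C C (comult C c) (\<lambda>c1 c'. sw H H (comult H h) (\<lambda>h1 h'. sw C C (comult C c') (\<lambda>c2 c3.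
          sw H H (comult H h') (\<lambda>h2 h3. ?f c1 c2 c3 h1 h2 h3))))"
      using c by (simp add: swap)
    also have "\<dots> = ?R (c \<otimes>[C, H] h)"
      using c by (simp add: sw_comult_pure[where U = ?U])
    finally show "?L (c \<otimes>[C, H] h) = ?R (c \<otimes>[C, H] h)" .
  qed (use that in simp_all)
  have counit_l: "sw D D (comult D d) (\<lambda>d1 d2. scl D (counit D d1) d2) = d" if "d \<in> carr D" for d
    by (rule tensor_ext_D[where t = d and U = D and g = "\<lambda>d. d"
        and f = "\<lambda>d. sw D D (comult D d) (\<lambda>d1 d2. scl D (counit D d1) d2)"])
      (use that in \<open>simp_all add: sw_comult_pure[where U = D] vspace_scl_distribs(3)[symmetric]
        sw_counit_left[where U = D] sw_scale[symmetric]\<close>)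
  have counit_r: "sw D D (comult D d) (\<lambda>d1 d2. scl D (counit D d2) d1) = d" if "d \<in> carr D" for d
    by (rule tensor_ext_D[where t = d and U = D and g = "\<lambda>d. d"
        and f = "\<lambda>d. sw D D (comult D d) (\<lambda>d1 d2. scl D (counit D d2) d1)"])
      (use that in \<open>simp_all add: sw_comult_pure[where U = D] vspace_scl_distribs(3)[symmetric]
        sw_counit_right[where U = D] sw_scale[symmetric]\<close>)
  have act_in [simp]: "act D d h \<in> carr D" if "d \<in> carr D" for d h
    by (rule klinear_in[OF klinear_tensor_act(1)[OF klinear_id] that])
  have coalgebra: "coalgebra D"
    unfolding coalgebra_def
    using coassoc counit_l counit_r comult_D_linear counit_D_linear vspace_D by blast
  have act_one: "act D d 1 = d" if "d \<in> carr D" for d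
    by (rule tensor_ext_D[where t = d and U = D and f = "\<lambda>d. act D d 1" and g = "\<lambda>d. d"])
      (use that in simp_all)
  have act_act: "act D (act D d g) h = act D d (g * h)" if "d \<in> carr D" for d g h
    by (rule tensor_ext_D[where t = d and U = D and f = "\<lambda>d. act D (act D d g) h" and g = "\<lambda>d. act D d (g * h)"])
      (use that in \<open>simp_all add: mult.assoc\<close>)
  have l' [simp]: "klinear H D (act D d)" if "d \<in> carr D" for d
    using klinear_tensor_act(2)[OF that klinear_id] by simp
  have module: "right_module H D (act D)"
    unfolding right_module_def using act_one act_act by simp
  have comult: "comult D (act D d g) =
      sw D D (comult D d) (\<lambda>d1 d2. sw H H (comult H g) (\<lambda>h1 h2. act D d1 h1 \<otimes>[D, D] act D d2 h2))"
    if "d \<in> carr D" for d g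
  proof (rule tensor_ext_D[where t = d and U = "D \<odot> D" and f = "\<lambda>d. comult D (act D d g)"
      and g = "\<lambda>d. sw D D (comult D d) (\<lambda>d1 d2. sw H H (comult H g) (\<lambda>h1 h2. act D d1 h1 \<otimes>[D, D] act D d2 h2))"])
    fix c h assume c: "c \<in> carr C"
    have "comult D (act D (c \<otimes>[C, H] h) g) = sw D D (comult D (c \<otimes>[C, H] (h * g))) (\<lambda>x y. x \<otimes>[D, D] y)"
      using c by simp
    also have "\<dots> = sw D D (comult D (c \<otimes>[C, H] h))
        (\<lambda>d1 d2. sw H H (comult H g) (\<lambda>h1 h2. act D d1 h1 \<otimes>[D, D] act D d2 h2))"
      using c by (simp add: sw_comult_pure[where U = "D \<odot> D"] sw_comult_mult[where U = "D \<odot> D"] del: sw_pure_id)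
    finally show "comult D (act D (c \<otimes>[C, H] h) g) = sw D D (comult D (c \<otimes>[C, H] h))
        (\<lambda>d1 d2. sw H H (comult H g) (\<lambda>h1 h2. act D d1 h1 \<otimes>[D, D] act D d2 h2))" .
  qed (use that in simp_all)
  have "counit D (act D d h) = counit D d * counit H h" if "d \<in> carr D" for d h
    by (rule tensor_ext_D[where t = d and U = ground and f = "\<lambda>d. counit D (act D d h)"
        and g = "\<lambda>d. counit D d * counit H h"])
      (use that in \<open>simp_all add: mult.assoc\<close>)
  with coalgebra module comult show ?thesis
    unfolding module_coalgebra_def by blast
qed

end

section \<open>Twistings of \<open>C \<otimes> H\<close> and crossed coproducts\<close>

context hopf_module_coalgebra
begin

lemma twisted_coassoc:
  assumes "module_coalgebra H (twist_coalg H D \<tau>)" "vspace U" "d \<in> carr D" "ktrilinear D D D U f"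
  shows "sw D D (twisted_comult H D \<tau> d) (\<lambda>x z. sw D D (twisted_comult H D \<tau> x) (\<lambda>x y. f x y z)) =
    sw D D (twisted_comult H D \<tau> d) (\<lambda>x y. sw D D (twisted_comult H D \<tau> y) (\<lambda>y z. f x y z))"
proof -
  let ?E = "twist_coalg H D \<tau>"
  have E: "carr ?E = carr D" "scl ?E = scl D" "comult ?E = twisted_comult H D \<tau>"
    by (auto simp: twist_coalg_def twisted_comult_def)
  have "ktrilinear ?E ?E ?E U f"
    using assms(4) by (simp add: E klinear_dom_cong[of ?E D])
  moreover have "coalgebra ?E"
    using assms(1) unfolding module_coalgebra_def by blast
  ultimately have "sw ?E ?E (comult ?E d) (\<lambda>x z. sw ?E ?E (comult ?E x) (\<lambda>x y. f x y z)) =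
      sw ?E ?E (comult ?E d) (\<lambda>x y. sw ?E ?E (comult ?E y) (\<lambda>y z. f x y z))"
    using sw_coassoc[of ?E U d f] assms(2,3) E(1) by blast
  then show ?thesis
    by (simp only: E(3) sw_left_cong[OF E(1,2)] sw_right_cong[OF E(1,2)])
qed

end

context hopf_coalgebra
begin

sublocale D: hopf_module_coalgebra H D
  by unfold_locales (rule module_coalgebra_D)

text \<open>The maps \<open>\<epsilon>\<^sub>C \<otimes> id : C \<otimes> H \<rightarrow> H\<close> and \<open>id \<otimes> \<epsilon>\<^sub>H : C \<otimes> H \<rightarrow> C\<close>.\<close>

definition left_counit :: "('k, 'c, 'h) tensor \<Rightarrow> 'h" where
  "left_counit t = sw C H t (\<lambda>c h. scl H (counit C c) h)"

definition right_counit :: "('k, 'c, 'h) tensor \<Rightarrow> 'c" where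
  "right_counit t = sw C H t (\<lambda>c h. scl C (counit H h) c)"

lemma left_counit_linear [simp]: "klinear X D g \<Longrightarrow> klinear X H (\<lambda>x. left_counit (g x))"
  by (simp add: left_counit_def)

lemma right_counit_linear [simp]: "klinear X D g \<Longrightarrow> klinear X C (\<lambda>x. right_counit (g x))"
  by (simp add: right_counit_def)

lemma right_counit_in [simp]: "t \<in> carr D \<Longrightarrow> right_counit t \<in> carr C"
  by (simp add: right_counit_def)

lemma left_counit_pure [simp]: "c \<in> carr C \<Longrightarrow> left_counit (c \<otimes>[C, H] h) = scl H (counit C c) h"
  by (simp add: left_counit_def sw_pure[where U = H])

lemma right_counit_pure [simp]: "c \<in> carr C \<Longrightarrow> right_counit (c \<otimes>[C, H] h) = scl C (counit H h) c"
  by (simp add: right_counit_def sw_pure[where U = C])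

lemma left_counit_act [simp]:
  assumes "t \<in> carr D"
  shows "left_counit (act D t g) = left_counit t * g"
  by (rule tensor_ext_D[where t = t and U = H and f = "\<lambda>t. left_counit (act D t g)"
        and g = "\<lambda>t. left_counit t * g"]) (use assms in \<open>simp_all add: mult_scale\<close>)

lemma right_counit_act [simp]:
  assumes "t \<in> carr D"
  shows "right_counit (act D t g) = scl C (counit H g) (right_counit t)"
  by (rule tensor_ext_D[where t = t and U = C and f = "\<lambda>t. right_counit (act D t g)"
        and g = "\<lambda>t. scl C (counit H g) (right_counit t)"])
    (use assms in \<open>simp_all add: vspace_scl_distribs mult.commute\<close>)

lemma sw_left_counit:
  "vspace V \<Longrightarrow> T \<in> carr (V \<odot> W) \<Longrightarrow> (\<And>a b. a \<in> carr V \<Longrightarrow> b \<in> carr W \<Longrightarrow> g a b \<in> carr D) \<Longrightarrow>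
    left_counit (sw V W T (\<lambda>a b. g a b)) = sw V W T (\<lambda>a b. left_counit (g a b))"
  by (rule klinear_sw[where f = left_counit and X = D and U = H]) simp_all

context
  fixes \<tau>
  assumes normalized: "normalized H D \<tau>"
    and twist: "module_coalgebra H (twist_coalg H D \<tau>)"
begin

lemma tau_linear: "klinear D (H \<odot> D) \<tau>"
  and tau_counit: "d \<in> carr D \<Longrightarrow> sw H D (\<tau> d) (\<lambda>x e. scl D (counit H x) e) = d"
  using normalized unfolding normalized_def by blast+

lemma klinear_tau [simp]: "klinear X D g \<Longrightarrow> klinear X (H \<odot> D) (\<lambda>x. \<tau> (g x))"
  by (rule klinear_comp[OF tau_linear])

lemma tau_in [simp]: "d \<in> carr D \<Longrightarrow> \<tau> d \<in> carr (H \<odot> D)"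
  by (rule klinear_in[OF tau_linear])

lemma twisted_comult_tau_linear [simp]: "klinear D (D \<odot> D) (twisted_comult H D \<tau>)"
  by (rule D.twisted_comult_linear[OF tau_linear])

lemma klinear_twisted_comult [simp]:
  "klinear X D g \<Longrightarrow> klinear X (D \<odot> D) (\<lambda>x. twisted_comult H D \<tau> (g x))"
  by (rule klinear_comp[OF twisted_comult_tau_linear])

lemma twisted_comult_in [simp]: "d \<in> carr D \<Longrightarrow> twisted_comult H D \<tau> d \<in> carr (D \<odot> D)"
  by (rule klinear_in[OF twisted_comult_tau_linear])

text \<open>
  Since \<open>c \<otimes> h = (c \<otimes> 1)\<cdot>h\<close> and \<open>\<Delta>\<^sub>\<tau>\<close> is right linear, \<open>\<Delta>\<^sub>\<tau>\<close> depends only on the elements \<open>\<tau>(c \<otimes> 1)\<close>.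
\<close>

lemma twisted_comult_pure:
  assumes c: "c \<in> carr C"
  shows "twisted_comult H D \<tau> (c \<otimes>[C, H] h) = sw C C (comult C c) (\<lambda>c1 c2.
    sw H D (\<tau> (c2 \<otimes>[C, H] 1)) (\<lambda>x e. sw H H (comult H h) (\<lambda>h1 h2.
      (c1 \<otimes>[C, H] (x * h1)) \<otimes>[D, D] act D e h2)))"
proof -
  have "twisted_comult H D \<tau> (c \<otimes>[C, H] h) = twisted_comult H D \<tau> (act D (c \<otimes>[C, H] 1) h)"
    using c by simp
  also have "\<dots> = sw D D (twisted_comult H D \<tau> (c \<otimes>[C, H] 1))
      (\<lambda>p q. sw H H (comult H h) (\<lambda>h1 h2. act D p h1 \<otimes>[D, D] act D q h2))"
    by (rule D.twisted_comult_act[OF twist]) (use c in simp)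
  finally have act: "twisted_comult H D \<tau> (c \<otimes>[C, H] h) = \<dots>" .
  have "twisted_comult H D \<tau> (c \<otimes>[C, H] 1) = sw C C (comult C c) (\<lambda>c1 c2.
    sw H D (\<tau> (c2 \<otimes>[C, H] 1)) (\<lambda>x e. (c1 \<otimes>[C, H] x) \<otimes>[D, D] e))"
    using c by (simp add: twisted_comult_def sw_comult_pure[where U = "D \<odot> D"] sw_comult_one[where U = "D \<odot> D"])
  then show ?thesis
    using c by (simp add: act sw_sw[where U = "D \<odot> D"] sw_pure[where U = "D \<odot> D"])
qed

lemma sw_twisted_comult_pure:
  assumes "vspace U" "kbilinear D D U f" "c \<in> carr C"
  shows "sw D D (twisted_comult H D \<tau> (c \<otimes>[C, H] h)) f = sw C C (comult C c) (\<lambda>c1 c2.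
    sw H D (\<tau> (c2 \<otimes>[C, H] 1)) (\<lambda>x e. sw H H (comult H h) (\<lambda>h1 h2.
      f (c1 \<otimes>[C, H] (x * h1)) (act D e h2))))"
  using assms by (simp add: twisted_comult_pure sw_sw[where U = U] sw_pure[where U = U])

text \<open>
  Normalization of \<open>\<tau>\<close> removes the twist once \<open>\<epsilon>\<^sub>H\<close> is applied to the first leg of \<open>\<Delta>\<^sub>\<tau>\<close>: what
  remains is \<open>c\<^sub>1 \<otimes> \<epsilon>\<^sub>C(c\<^sub>2)h\<close>.
\<close>

lemma twisted_comult_counits:
  assumes t: "t \<in> carr D"
  shows "sw D D (twisted_comult H D \<tau> t) (\<lambda>p q. right_counit p \<otimes>[C, H] left_counit q) = t"
proof (rule tensor_ext_D[where t = t and U = D and g = "\<lambda>t. t"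
      and f = "\<lambda>t. sw D D (twisted_comult H D \<tau> t) (\<lambda>p q. right_counit p \<otimes>[C, H] left_counit q)"])
  fix c h assume c: "c \<in> carr C"
  have e: "sw H D (\<tau> d) (\<lambda>x e. scl H (counit H x) (left_counit e)) = left_counit d" if "d \<in> carr D" for d
  proof -
    have "left_counit (sw H D (\<tau> d) (\<lambda>x e. scl D (counit H x) e)) = sw H D (\<tau> d) (\<lambda>x e. scl H (counit H x) (left_counit e))"
      using that klinear_scl[OF left_counit_linear[OF klinear_id]] by (simp add: sw_left_counit)
    then show ?thesis using that by (simp add: tau_counit)
  qed
  have "sw D D (twisted_comult H D \<tau> (c \<otimes>[C, H] h)) (\<lambda>p q. right_counit p \<otimes>[C, H] left_counit q) =
      sw C C (comult C c) (\<lambda>c1 c2. sw H D (\<tau> (c2 \<otimes>[C, H] 1)) (\<lambda>x e. sw H H (comult H h) (\<lambda>h1 h2.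
        scl D (counit H h1) (c1 \<otimes>[C, H] (scl H (counit H x) (left_counit e) * h2)))))"
    using c by (simp add: sw_twisted_comult_pure[where U = D] pure_scale_D mult_scale vspace_scl_distribs mult.commute)
  also have "\<dots> = sw C C (comult C c) (\<lambda>c1 c2. c1 \<otimes>[C, H]
      (sw H D (\<tau> (c2 \<otimes>[C, H] 1)) (\<lambda>x e. scl H (counit H x) (left_counit e)) * h))"
    using c by (simp add: sw_counit_left sw_pure_right sw_mult)
  also have "\<dots> = c \<otimes>[C, H] h"
    using c by (simp add: e mult_scale pure_scale_D sw_counit_right)
  finally show "sw D D (twisted_comult H D \<tau> (c \<otimes>[C, H] h)) (\<lambda>p q. right_counit p \<otimes>[C, H] left_counit q) =
      c \<otimes>[C, H] h" .
qed (use t in simp_all)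

lemma corresponding_coaction_eq:
  "c \<in> carr C \<Longrightarrow> corresponding_coaction H C \<tau> c =
    sw H D (\<tau> (c \<otimes>[C, H] 1)) (\<lambda>x e. x \<otimes>[H, C] right_counit e)"
  by (simp add: corresponding_coaction_def right_counit_def sw_pure_right)

lemma corresponding_cocycle_eq:
  "c \<in> carr C \<Longrightarrow> corresponding_cocycle H C \<tau> c =
    sw H D (\<tau> (c \<otimes>[C, H] 1)) (\<lambda>x e. x \<otimes>[H, H] left_counit e)"
  by (simp add: corresponding_cocycle_def left_counit_def sw_pure_right)

text \<open>
  In view of \<open>corresponding_coaction_eq\<close> and \<open>corresponding_cocycle_eq\<close>, the right side is the
  product of \<open>\<rho>(c\<^sub>1)\<close> and \<open>\<alpha>(c\<^sub>2)\<close>. It is the image of \<open>(\<Delta>\<^sub>\<tau> \<otimes> id)\<Delta>\<^sub>\<tau>(c \<otimes> 1)\<close> under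
  \<open>(\<epsilon>\<^sub>C \<otimes> id) \<otimes> (id \<otimes> \<epsilon>\<^sub>H) \<otimes> (\<epsilon>\<^sub>C \<otimes> id)\<close>, while \<open>(id \<otimes> \<Delta>\<^sub>\<tau>)\<Delta>\<^sub>\<tau>(c \<otimes> 1)\<close> is mapped to \<open>\<tau>(c \<otimes> 1)\<close> by
  \<open>twisted_comult_counits\<close>.
\<close>

lemma tau_factors:
  assumes c: "c \<in> carr C"
  shows "\<tau> (c \<otimes>[C, H] 1) = sw C C (comult C c) (\<lambda>c1 c2. sw H D (\<tau> (c1 \<otimes>[C, H] 1)) (\<lambda>y e'.
    sw H D (\<tau> (c2 \<otimes>[C, H] 1)) (\<lambda>x e. (y * x) \<otimes>[H, D] (right_counit e' \<otimes>[C, H] left_counit e))))"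
proof -
  let ?U = "H \<odot> D"
  let ?f = "\<lambda>p q r. left_counit p \<otimes>[H, D] (right_counit q \<otimes>[C, H] left_counit r)"
  let ?d = "c \<otimes>[C, H] 1"
  have "sw D D (twisted_comult H D \<tau> ?d) (\<lambda>x z. sw D D (twisted_comult H D \<tau> x) (\<lambda>x y. ?f x y z)) =
      sw D D (twisted_comult H D \<tau> ?d) (\<lambda>x y. sw D D (twisted_comult H D \<tau> y) (\<lambda>y z. ?f x y z))"
    by (rule D.twisted_coassoc[OF twist, where U = ?U]) (use c in simp_all)
  also have "\<dots> = sw D D (twisted_comult H D \<tau> ?d) (\<lambda>x y. left_counit x \<otimes>[H, D] y)"
    using c by (simp add: sw_pure_right[symmetric] twisted_comult_counits)
  also have "\<dots> = sw C C (comult C c) (\<lambda>c1 c2. scl ?U (counit C c1) (sw H D (\<tau> (c2 \<otimes>[C, H] 1)) (\<lambda>x e. x \<otimes>[H, D] e)))"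
    using c by (simp add: sw_twisted_comult_pure[where U = ?U] sw_comult_one[where U = ?U] sw_scale pure_scale del: sw_pure_id)
  also have "\<dots> = \<tau> ?d"
    using c by (simp add: sw_counit_left)
  finally have "\<tau> ?d = sw D D (twisted_comult H D \<tau> ?d)
      (\<lambda>x z. sw D D (twisted_comult H D \<tau> x) (\<lambda>x y. ?f x y z))" by simp
  also have "\<dots> = sw C C (comult C c) (\<lambda>c1 c2. sw H D (\<tau> (c2 \<otimes>[C, H] 1)) (\<lambda>x e.
      sw D D (twisted_comult H D \<tau> (c1 \<otimes>[C, H] x)) (\<lambda>p q. ?f p q e)))"
    using c by (simp add: sw_twisted_comult_pure[where U = ?U, of _ c 1] sw_comult_one[where U = ?U])
  also have "\<dots> = sw C C (comult C c) (\<lambda>c1 c2. sw H D (\<tau> (c2 \<otimes>[C, H] 1)) (\<lambda>x e.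
      sw C C (comult C c1) (\<lambda>a b. scl ?U (counit C a) (sw H D (\<tau> (b \<otimes>[C, H] 1)) (\<lambda>y e'.
        sw H H (comult H x) (\<lambda>x1 x2. scl ?U (counit H x2)
          ((y * x1) \<otimes>[H, D] (right_counit e' \<otimes>[C, H] left_counit e))))))))"
    using c by (simp add: sw_twisted_comult_pure[where U = ?U] sw_scale pure_scale pure_scale_D
        vspace_scl_distribs(3) mult.commute)
  also have "\<dots> = sw C C (comult C c) (\<lambda>c1 c2. sw H D (\<tau> (c2 \<otimes>[C, H] 1)) (\<lambda>x e.
      sw H D (\<tau> (c1 \<otimes>[C, H] 1)) (\<lambda>y e'. (y * x) \<otimes>[H, D] (right_counit e' \<otimes>[C, H] left_counit e))))"
    using c by (simp add: sw_counit_left sw_counit_right)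
  also have "\<dots> = sw C C (comult C c) (\<lambda>c1 c2. sw H D (\<tau> (c1 \<otimes>[C, H] 1)) (\<lambda>y e'.
      sw H D (\<tau> (c2 \<otimes>[C, H] 1)) (\<lambda>x e. (y * x) \<otimes>[H, D] (right_counit e' \<otimes>[C, H] left_counit e))))"
    by (rule sw_cong[OF refl _ sw_swap]) (use c in simp)
  finally show ?thesis .
qed

end

text \<open>
  Insert \<open>tau_factors\<close> into \<open>twisted_comult_pure\<close>; on pure tensors this is the defining formula of the
  crossed coproduct.
\<close>

lemma comult_crossed_coproduct:
  assumes "normalized H D \<tau>" "module_coalgebra H (twist_coalg H D \<tau>)"
    and \<rho>: "\<And>c. c \<in> carr C \<Longrightarrow> \<rho> c = corresponding_coaction H C \<tau> c"
    and \<alpha>: "\<And>c. c \<in> carr C \<Longrightarrow> \<alpha> c = corresponding_cocycle H C \<tau> c"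
    and t: "t \<in> carr D"
  shows "comult (crossed_coproduct H C \<rho> \<alpha>) t = twisted_comult H D \<tau> t"
proof -
  note [simp] = klinear_tau[OF assms(1,2)] tau_in[OF assms(1,2)] twisted_comult_tau_linear[OF assms(1,2)]
  note r = corresponding_coaction_eq[OF assms(1,2)] corresponding_cocycle_eq[OF assms(1,2)]
  have \<tau>: "\<tau> (c \<otimes>[C, H] 1) = sw C C (comult C c) (\<lambda>c1 c2. sw H C (\<rho> c1) (\<lambda>x e.
      sw H H (\<alpha> c2) (\<lambda>a b. (x * a) \<otimes>[H, D] (e \<otimes>[C, H] b))))" if "c \<in> carr C" for c
    using that by (subst tau_factors[OF assms(1,2)])
      (simp_all add: \<rho> \<alpha> r sw_sw[where U = "H \<odot> D"] sw_pure[where U = "H \<odot> D"])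
  have [simp]: "\<rho> c \<in> carr (H \<odot> C)" "\<alpha> c \<in> carr (H \<odot> H)" if "c \<in> carr C" for c
    using that by (simp_all add: \<rho> \<alpha> r)
  have "twisted_comult H D \<tau> t = twisted_comult H D \<tau> (sw C H t (\<lambda>c h. c \<otimes>[C, H] h))"
    using t by simp
  also have "\<dots> = sw C H t (\<lambda>c h. twisted_comult H D \<tau> (c \<otimes>[C, H] h))"
    by (rule klinear_sw[where X = D and U = "D \<odot> D"]) (use t in simp_all)
  also have "\<dots> = sw C H t (\<lambda>c h.
      sw C C (comult C c) (\<lambda>c1 c'. sw C C (comult C c') (\<lambda>c2 c3.
        sw H C (\<rho> c2) (\<lambda>x e. sw H H (\<alpha> c3) (\<lambda>a b. sw H H (comult H h) (\<lambda>h1 h2.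
          (c1 \<otimes>[C, H] (x * a * h1)) \<otimes>[D, D] (e \<otimes>[C, H] (b * h2))))))))"
    using t by (simp add: twisted_comult_pure[OF assms(1,2)] \<tau> sw_sw[where U = "D \<odot> D"] sw_pure[where U = "D \<odot> D"])
  finally show ?thesis
    using t by (simp add: crossed_coproduct_def)
qed

section \<open>Colinear endomorphisms of \<open>C \<otimes> H\<close>\<close>

definition colinear_map :: "('c \<Rightarrow> 'h) \<Rightarrow> ('k, 'c, 'h) tensor \<Rightarrow> ('k, 'c, 'h) tensor" where
  "colinear_map u t = sw C H t (\<lambda>c h. sw C C (comult C c) (\<lambda>c1 c2. c1 \<otimes>[C, H] (u c2 * h)))"

definition convolution :: "('c \<Rightarrow> 'h) \<Rightarrow> ('c \<Rightarrow> 'h) \<Rightarrow> 'c \<Rightarrow> 'h" where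
  "convolution u u' c = sw C C (comult C c) (\<lambda>c1 c2. u c1 * u' c2)"

lemma left_coaction_linear [simp]:
  "klinear X D g \<Longrightarrow> klinear X (C \<odot> D) (\<lambda>x. left_coaction H C (g x))"
  by (simp add: left_coaction_def)

lemma left_coaction_in [simp]: "t \<in> carr D \<Longrightarrow> left_coaction H C t \<in> carr (C \<odot> D)"
  by (simp add: left_coaction_def)

lemma left_coaction_pure:
  "c \<in> carr C \<Longrightarrow> left_coaction H C (c \<otimes>[C, H] h) =
    sw C C (comult C c) (\<lambda>c1 c2. c1 \<otimes>[C, D] (c2 \<otimes>[C, H] h))"
  by (simp add: left_coaction_def sw_pure[where U = "C \<odot> D"])

lemma left_colinear_iff:
  "left_colinear H C f \<longleftrightarrow>
    (\<forall>t\<in>carr D. left_coaction H C (f t) = sw C D (left_coaction H C t) (\<lambda>c s. c \<otimes>[C, D] f s))"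
  by (simp add: left_colinear_def)

text \<open>
  \<open>c\<^sub>1 \<otimes> \<epsilon>\<^sub>C(c\<^sub>2)h = c \<otimes> h\<close>: an element can be read off from its coaction and \<open>\<epsilon>\<^sub>C \<otimes> id\<close>. Therefore a
  colinear map is determined by its composite with \<open>\<epsilon>\<^sub>C \<otimes> id\<close>.
\<close>

lemma left_coaction_counit:
  assumes t: "t \<in> carr D"
  shows "sw C D (left_coaction H C t) (\<lambda>c s. c \<otimes>[C, H] left_counit s) = t"
  by (rule tensor_ext_D[where t = t and U = D and g = "\<lambda>t. t"
      and f = "\<lambda>t. sw C D (left_coaction H C t) (\<lambda>c s. c \<otimes>[C, H] left_counit s)"])
    (use t in \<open>simp_all add: left_coaction_pure sw_sw[where U = D] sw_pure[where U = D] pure_scale_D sw_counit_right\<close>)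

lemma counit_left_counit:
  assumes t: "t \<in> carr D"
  shows "counit H (left_counit t) = counit D t"
  by (rule tensor_ext_D[where t = t and U = ground and f = "\<lambda>t. counit H (left_counit t)" and g = "counit D"])
    (use t klinear_scl[OF counit_linear[OF coalgebra_H]] in simp_all)

lemma klinear_convolution:
  assumes "klinear C H u" "klinear C H u'"
  shows "klinear C H (convolution u u')"
  by (simp add: convolution_def[abs_def] assms klinear_comp[OF assms(1)] klinear_comp[OF assms(2)])

context
  fixes u
  assumes u: "klinear C H u"
begin

lemma klinear_u [simp]: "klinear X C g \<Longrightarrow> klinear X H (\<lambda>x. u (g x))"
  by (rule klinear_comp[OF u])

lemma colinear_map_linear [simp]: "klinear X D g \<Longrightarrow> klinear X D (\<lambda>x. colinear_map u (g x))"
  by (simp add: colinear_map_def)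

lemma colinear_map_in [simp]: "t \<in> carr D \<Longrightarrow> colinear_map u t \<in> carr D"
  by (simp add: colinear_map_def)

lemma colinear_map_pure:
  "c \<in> carr C \<Longrightarrow> colinear_map u (c \<otimes>[C, H] h) = sw C C (comult C c) (\<lambda>c1 c2. c1 \<otimes>[C, H] (u c2 * h))"
  by (simp add: colinear_map_def sw_pure[where U = D])

lemma left_counit_colinear_map:
  "c \<in> carr C \<Longrightarrow> left_counit (colinear_map u (c \<otimes>[C, H] h)) = u c * h"
  by (simp add: colinear_map_pure sw_left_counit mult_scale sw_counit_left)

lemma left_colinear_colinear_map: "left_colinear H C (colinear_map u)"
  unfolding left_colinear_iff
proof
  fix t assume t: "t \<in> carr D"
  let ?f = "\<lambda>t. sw C D (left_coaction H C t) (\<lambda>c s. c \<otimes>[C, D] colinear_map u s)"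
  show "left_coaction H C (colinear_map u t) = ?f t"
  proof (rule tensor_ext_D[where t = t and U = "C \<odot> D" and f = "\<lambda>t. left_coaction H C (colinear_map u t)" and g = ?f])
    fix c h assume c: "c \<in> carr C"
    have "left_coaction H C (colinear_map u (c \<otimes>[C, H] h)) =
        sw C C (comult C c) (\<lambda>c1 c2. left_coaction H C (c1 \<otimes>[C, H] (u c2 * h)))"
      unfolding colinear_map_pure[OF c]
      by (rule klinear_sw[where X = D and U = "C \<odot> D"]) (use c in simp_all)
    also have "\<dots> = ?f (c \<otimes>[C, H] h)"
      using c by (simp add: left_coaction_pure sw_coassoc[where U = "C \<odot> D"] sw_sw[where U = "C \<odot> D"]
          sw_pure[where U = "C \<odot> D"] colinear_map_pure sw_pure_right)
    finally show "left_coaction H C (colinear_map u (c \<otimes>[C, H] h)) = ?f (c \<otimes>[C, H] h)" .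
  qed (use t in simp_all)
qed

end

text \<open>
  \<open>c\<^sub>1 \<otimes> u'(c\<^sub>2)h\<close> is sent to \<open>c\<^sub>1 \<otimes> u(c\<^sub>2)u'(c\<^sub>3)h\<close>.
\<close>

lemma colinear_map_convolution:
  assumes u: "klinear C H u" and u': "klinear C H u'" and t: "t \<in> carr D"
  shows "colinear_map u (colinear_map u' t) = colinear_map (convolution u u') t"
proof -
  note [simp] = klinear_u[OF u] klinear_u[OF u'] colinear_map_linear[OF u] colinear_map_linear[OF u']
    colinear_map_linear[OF klinear_convolution[OF u u']]
  show ?thesis
  proof (rule tensor_ext_D[where t = t and U = D and f = "\<lambda>t. colinear_map u (colinear_map u' t)" and g = "colinear_map (convolution u u')"])
    fix c h assume c: "c \<in> carr C"
    have "colinear_map u (colinear_map u' (c \<otimes>[C, H] h)) =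
        sw C C (comult C c) (\<lambda>c1 c2. colinear_map u (c1 \<otimes>[C, H] (u' c2 * h)))"
      unfolding colinear_map_pure[OF u' c]
      by (rule klinear_sw[where X = D and U = D]) (use c in simp_all)
    also have "\<dots> = sw C C (comult C c) (\<lambda>c1 c'. sw C C (comult C c') (\<lambda>c2 c3. c1 \<otimes>[C, H] (u c2 * u' c3 * h)))"
      using c by (simp add: colinear_map_pure[OF u] sw_coassoc[where U = D] mult.assoc)
    also have "\<dots> = colinear_map (convolution u u') (c \<otimes>[C, H] h)"
      using c by (simp add: colinear_map_pure[OF klinear_convolution[OF u u']] convolution_def sw_pure_right sw_mult)
    finally show "colinear_map u (colinear_map u' (c \<otimes>[C, H] h)) = colinear_map (convolution u u') (c \<otimes>[C, H] h)" .
  qed (use t colinear_map_linear[OF klinear_convolution[OF u u'] klinear_id] in simp_all)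
qed

lemma colinear_map_unit:
  assumes u: "\<And>c. c \<in> carr C \<Longrightarrow> u c = scl H (counit C c) 1" and t: "t \<in> carr D"
  shows "colinear_map u t = t"
proof -
  have "colinear_map u t = sw C H t (\<lambda>c h. c \<otimes>[C, H] h)"
    unfolding colinear_map_def
    by (rule sw_cong) (use t in \<open>simp_all add: u mult_scale pure_scale_D sw_counit_right\<close>)
  then show ?thesis using t by simp
qed

text \<open>
  By right linearity \<open>f\<close> is determined on \<open>C \<otimes> 1\<close>. Colinearity says that the coaction of \<open>f(c \<otimes> 1)\<close> is
  \<open>c\<^sub>1 \<otimes> f(c\<^sub>2 \<otimes> 1)\<close>, and \<open>left_coaction_counit\<close> gives \<open>f(c \<otimes> 1) = c\<^sub>1 \<otimes> u(c\<^sub>2)\<close>.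
\<close>

lemma colinear_map_characterization:
  assumes f: "klinear D D f" and col: "left_colinear H C f"
    and lin: "\<And>t h. t \<in> carr D \<Longrightarrow> f (act D t h) = act D (f t) h"
  obtains u where "klinear C H u" "\<And>t. t \<in> carr D \<Longrightarrow> f t = colinear_map u t"
    "\<And>c. c \<in> carr C \<Longrightarrow> u c = left_counit (f (c \<otimes>[C, H] 1))"
proof
  define u where "u = (\<lambda>c. left_counit (f (c \<otimes>[C, H] 1)))"
  note [simp] = klinear_comp[OF f] klinear_in[OF f]
  show u: "klinear C H u"
    unfolding u_def by simp
  show "u c = left_counit (f (c \<otimes>[C, H] 1))" for c
    by (simp add: u_def)
  have one: "f (c \<otimes>[C, H] 1) = sw C C (comult C c) (\<lambda>c1 c2. c1 \<otimes>[C, H] u c2)" if c: "c \<in> carr C" for c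
  proof -
    have "f (c \<otimes>[C, H] 1) = sw C D (left_coaction H C (f (c \<otimes>[C, H] 1))) (\<lambda>c s. c \<otimes>[C, H] left_counit s)"
      by (rule left_coaction_counit[symmetric]) (use c in simp)
    also have "left_coaction H C (f (c \<otimes>[C, H] 1)) =
        sw C D (left_coaction H C (c \<otimes>[C, H] 1)) (\<lambda>c s. c \<otimes>[C, D] f s)"
      using col c unfolding left_colinear_iff by simp
    also have "\<dots> = sw C C (comult C c) (\<lambda>c1 c2. c1 \<otimes>[C, D] f (c2 \<otimes>[C, H] 1))"
      using c by (simp add: left_coaction_pure sw_sw[where U = "C \<odot> D"] sw_pure[where U = "C \<odot> D"])
    also have "sw C D \<dots> (\<lambda>c s. c \<otimes>[C, H] left_counit s) = sw C C (comult C c) (\<lambda>c1 c2. c1 \<otimes>[C, H] u c2)"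
      using c by (simp add: sw_sw[where U = D] sw_pure[where U = D] u_def)
    finally show ?thesis .
  qed
  show "f t = colinear_map u t" if t: "t \<in> carr D" for t
  proof (rule tensor_ext_D[where t = t and U = D and f = f and g = "colinear_map u"])
    fix c h assume c: "c \<in> carr C"
    have "f (c \<otimes>[C, H] h) = act D (f (c \<otimes>[C, H] 1)) h"
      using lin[of "c \<otimes>[C, H] 1" h] c by simp
    also have "\<dots> = colinear_map u (c \<otimes>[C, H] h)"
      using c klinear_u[OF u] by (simp add: one D.sw_act colinear_map_pure[OF u])
    finally show "f (c \<otimes>[C, H] h) = colinear_map u (c \<otimes>[C, H] h)" .
  qed (use t f colinear_map_linear[OF u klinear_id] in simp_all)
qed

section \<open>Equivariant extensions\<close>

text \<open>
  The condition \<open>v(d\<cdot>h) = S(h\<^sub>1) v(d) h\<^sub>2\<close> leaves no choice for \<open>v(c \<otimes> h)\<close> once \<open>v(c \<otimes> 1) = u(c)\<close> is given.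
\<close>

definition equivariant_extension :: "('c \<Rightarrow> 'h) \<Rightarrow> ('k, 'c, 'h) tensor \<Rightarrow> 'h" where
  "equivariant_extension u t = sw C H t (\<lambda>c h. sw H H (comult H h) (\<lambda>h1 h2. S h1 * u c * h2))"

context
  fixes u
  assumes u: "klinear C H u"
begin

lemmas [simp] = klinear_u[OF u]

lemma equivariant_extension_linear [simp]:
  "klinear X D g \<Longrightarrow> klinear X H (\<lambda>x. equivariant_extension u (g x))"
  by (simp add: equivariant_extension_def)

lemma equivariant_extension_linear': "klinear D H (equivariant_extension u)"
  using equivariant_extension_linear[OF klinear_id] .

lemma equivariant_extension_pure:
  "c \<in> carr C \<Longrightarrow> equivariant_extension u (c \<otimes>[C, H] h) = sw H H (comult H h) (\<lambda>h1 h2. S h1 * u c * h2)"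
  by (simp add: equivariant_extension_def sw_pure[where U = H])

text \<open>
  This holds for \<open>(c \<otimes> h)\<cdot>g = c \<otimes> hg\<close> because the antipode reverses products.
\<close>

lemma equivariant_extension_act:
  assumes t: "t \<in> carr D"
  shows "equivariant_extension u (act D t g) =
    sw H H (comult H g) (\<lambda>g1 g2. S g1 * equivariant_extension u t * g2)"
proof (rule tensor_ext_D[where t = t and U = H and f = "\<lambda>t. equivariant_extension u (act D t g)"
      and g = "\<lambda>t. sw H H (comult H g) (\<lambda>g1 g2. S g1 * equivariant_extension u t * g2)"])
  fix c h assume c: "c \<in> carr C"
  have "equivariant_extension u (act D (c \<otimes>[C, H] h) g) = sw H H (comult H h) (\<lambda>h1 h2.
      sw H H (comult H g) (\<lambda>g1 g2. S g1 * (S h1 * u c * h2) * g2))"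
    using c by (simp add: equivariant_extension_pure sw_comult_mult[where U = H] antipode_mult mult.assoc)
  also have "\<dots> = sw H H (comult H g) (\<lambda>g1 g2. sw H H (comult H h) (\<lambda>h1 h2. S g1 * (S h1 * u c * h2) * g2))"
    by (rule sw_swap)
  also have "\<dots> = sw H H (comult H g) (\<lambda>g1 g2. S g1 * equivariant_extension u (c \<otimes>[C, H] h) * g2)"
    using c by (simp add: equivariant_extension_pure sw_mult)
  finally show "equivariant_extension u (act D (c \<otimes>[C, H] h) g) =
      sw H H (comult H g) (\<lambda>g1 g2. S g1 * equivariant_extension u (c \<otimes>[C, H] h) * g2)" .
qed (use t in simp_all)

lemma counit_equivariant_extension:
  assumes eps: "\<And>c. c \<in> carr C \<Longrightarrow> counit H (u c) = counit C c" and t: "t \<in> carr D"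
  shows "counit H (equivariant_extension u t) = counit D t"
proof (rule tensor_ext_D[where t = t and U = ground and f = "\<lambda>t. counit H (equivariant_extension u t)"
      and g = "counit D"])
  fix c h assume c: "c \<in> carr C"
  have "counit H (equivariant_extension u (c \<otimes>[C, H] h)) =
      sw H H (comult H h) (\<lambda>h1 h2. counit H (S h1 * u c * h2))"
    unfolding equivariant_extension_pure[OF c]
    by (rule klinear_sw[where X = H and U = ground]) simp_all
  also have "\<dots> = sw H H (comult H h) (\<lambda>h1 h2. scl ground (counit H h1) (counit C c * counit H h2))"
    using c by (simp add: eps mult_ac)
  also have "\<dots> = counit C c * counit H h"
    by (rule sw_counit_left) simp_all
  finally show "counit H (equivariant_extension u (c \<otimes>[C, H] h)) = counit D (c \<otimes>[C, H] h)"
    using c by simp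
qed (use t in simp_all)

text \<open>
  \<open>(c\<^sub>1 \<otimes> h\<^sub>1)\<cdot>S(h\<^sub>2) u(c\<^sub>2) h\<^sub>3 = c\<^sub>1 \<otimes> u(c\<^sub>2) h\<close>.
\<close>

lemma gauge_equivariant_extension:
  assumes t: "t \<in> carr D"
  shows "gauge D (equivariant_extension u) t = colinear_map u t"
proof (rule tensor_ext_D[where t = t and U = D and f = "gauge D (equivariant_extension u)" and g = "colinear_map u"])
  fix c h assume c: "c \<in> carr C"
  have "gauge D (equivariant_extension u) (c \<otimes>[C, H] h) =
      sw C C (comult C c) (\<lambda>c1 c2. sw H H (comult H h) (\<lambda>h1 h'. sw H H (comult H h') (\<lambda>h2 h3.
        c1 \<otimes>[C, H] (h1 * S h2 * (u c2 * h3)))))"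
    using c by (simp add: gauge_def sw_comult_pure[where U = D] equivariant_extension_pure sw_mult
        sw_pure_right mult.assoc)
  also have "\<dots> = colinear_map u (c \<otimes>[C, H] h)"
    using c by (simp add: colinear_map_pure[OF u]
        sw_antipode_cancel_right[where U = D and f = "\<lambda>x y. _ \<otimes>[C, H] (x * (u _ * y))"])
  finally show "gauge D (equivariant_extension u) (c \<otimes>[C, H] h) = colinear_map u (c \<otimes>[C, H] h)" .
qed (use t D.gauge_linear[OF equivariant_extension_linear'] colinear_map_linear[OF u klinear_id] in simp_all)

end

text \<open>
  \<open>S(h\<^sub>1) u(c\<^sub>1) h\<^sub>2 S(h\<^sub>3) u'(c\<^sub>2) h\<^sub>4 = S(h\<^sub>1) u(c\<^sub>1) u'(c\<^sub>2) h\<^sub>2\<close>, so a convolution inverse on \<open>C\<close> extends to one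
  on \<open>C \<otimes> H\<close>.
\<close>

lemma equivariant_extension_inverse:
  assumes u: "klinear C H u" and u': "klinear C H u'"
    and inv: "\<And>c. c \<in> carr C \<Longrightarrow> convolution u u' c = scl H (counit C c) 1"
    and t: "t \<in> carr D"
  shows "sw D D (comult D t) (\<lambda>d1 d2. equivariant_extension u d1 * equivariant_extension u' d2) =
    scl H (counit D t) 1"
proof -
  note [simp] = klinear_u[OF u] klinear_u[OF u'] equivariant_extension_linear[OF u] equivariant_extension_linear[OF u']
    equivariant_extension_linear'[OF u] equivariant_extension_linear'[OF u']
  let ?f = "\<lambda>t. sw D D (comult D t) (\<lambda>d1 d2. equivariant_extension u d1 * equivariant_extension u' d2)"
  show ?thesis
  proof (rule tensor_ext_D[where t = t and U = H and f = ?f and g = "\<lambda>t. scl H (counit D t) 1"])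
    fix c h assume c: "c \<in> carr C"
    have "?f (c \<otimes>[C, H] h) = sw C C (comult C c) (\<lambda>c1 c2. sw H H (comult H h) (\<lambda>h1 h'. sw H H (comult H h') (\<lambda>h2 h''.
        sw H H (comult H h'') (\<lambda>h3 h4. S h1 * (u c1 * (h2 * S h3 * (u' c2 * h4)))))))"
      using c by (simp add: sw_comult_pure[where U = H] equivariant_extension_pure[OF u]
          equivariant_extension_pure[OF u'] sw_mult(1) mult.assoc)
        (simp add: sw_mult(2) sw_coassoc[where U = H])
    also have "\<dots> = sw C C (comult C c) (\<lambda>c1 c2. sw H H (comult H h) (\<lambda>h1 h'. S h1 * (u c1 * (u' c2 * h'))))"
      using c by (simp add: sw_antipode_cancel_right[where U = H and f = "\<lambda>x y. _ * (u _ * (x * (u' _ * y)))"])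
    also have "\<dots> = sw H H (comult H h) (\<lambda>h1 h'. sw C C (comult C c) (\<lambda>c1 c2. S h1 * (u c1 * (u' c2 * h'))))"
      by (rule sw_swap)
    also have "\<dots> = sw H H (comult H h) (\<lambda>h1 h'. S h1 * (convolution u u' c * h'))"
      using c by (simp add: convolution_def sw_mult mult.assoc)
    also have "\<dots> = scl H (counit D (c \<otimes>[C, H] h)) 1"
      using c by (simp add: inv mult_scale sw_scale[symmetric] antipode_axioms vspace_scl_distribs(3))
    finally show "?f (c \<otimes>[C, H] h) = scl H (counit D (c \<otimes>[C, H] h)) 1" .
  qed (use t in simp_all)
qed

section \<open>Cancelling the first factor in \<open>d\<^sub>1\<cdot>X(d\<^sub>2)\<close>\<close>

text \<open>
  For \<open>d = c \<otimes> h\<close>, applying \<open>\<epsilon>\<^sub>C \<otimes> id\<close> to the first leg of \<open>d\<^sub>1\<cdot>X(d\<^sub>2)\<close> leaves \<open>h\<^sub>1 X(c \<otimes> h\<^sub>2)\<close>, with \<open>h\<^sub>1\<close>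
  multiplying the leg of \<open>X\<close> in \<open>H\<close>, and \<open>S(h\<^sub>1) h\<^sub>2 X(c \<otimes> h\<^sub>3) = X(c \<otimes> h)\<close>.
\<close>

lemma twisted_comult_recovers:
  assumes X: "klinear D (H \<odot> D) X" and c: "c \<in> carr C"
  shows "sw H H (comult H h) (\<lambda>h1 h2. sw D D (twisted_comult H D X (c \<otimes>[C, H] h2))
    (\<lambda>p q. (S h1 * left_counit p) \<otimes>[H, D] q)) = X (c \<otimes>[C, H] h)"
proof -
  let ?U = "H \<odot> D"
  note [simp] = klinear_comp[OF X] klinear_in[OF X]
  have "sw H H (comult H h) (\<lambda>h1 h2. sw D D (twisted_comult H D X (c \<otimes>[C, H] h2))
      (\<lambda>p q. (S h1 * left_counit p) \<otimes>[H, D] q)) =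
    sw H H (comult H h) (\<lambda>h1 h'. sw C C (comult C c) (\<lambda>c1 c2. scl ?U (counit C c1) (
      sw H H (comult H h') (\<lambda>h2 h3. sw H D (X (c2 \<otimes>[C, H] h3)) (\<lambda>x e. (S h1 * h2 * x) \<otimes>[H, D] e)))))"
    using c by (simp add: twisted_comult_def sw_comult_pure[where U = "D \<odot> D"] sw_sw[where U = ?U]
        sw_pure[where U = ?U] sw_scale pure_scale mult_scale mult.assoc)
  also have "\<dots> = sw H H (comult H h) (\<lambda>h1 h'. sw H H (comult H h') (\<lambda>h2 h3.
      sw H D (X (c \<otimes>[C, H] h3)) (\<lambda>x e. (S h1 * h2 * x) \<otimes>[H, D] e)))"
    using c by (simp add: sw_counit_left)
  also have "\<dots> = sw H D (X (c \<otimes>[C, H] h)) (\<lambda>x e. (1 * x) \<otimes>[H, D] e)"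
    by (rule sw_antipode_cancel_left[where U = ?U and f = "\<lambda>y z. sw H D (X (c \<otimes>[C, H] z)) (\<lambda>x e. (y * x) \<otimes>[H, D] e)"])
      (use c in simp_all)
  finally show ?thesis
    using c by simp
qed

lemma twisted_comult_cancel:
  assumes X: "klinear D (H \<odot> D) X" and Y: "klinear D (H \<odot> D) Y"
    and eq: "\<And>d. d \<in> carr D \<Longrightarrow> twisted_comult H D X d = twisted_comult H D Y d"
    and d: "d \<in> carr D"
  shows "X d = Y d"
proof -
  note [simp] = klinear_in[OF D.twisted_comult_linear[OF Y]]
  show ?thesis
  proof (rule tensor_ext_D[where t = d and U = "H \<odot> D" and f = X and g = Y])
    fix c h assume c: "c \<in> carr C"
    have "X (c \<otimes>[C, H] h) = sw H H (comult H h) (\<lambda>h1 h2. sw D D (twisted_comult H D X (c \<otimes>[C, H] h2))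
        (\<lambda>p q. (S h1 * left_counit p) \<otimes>[H, D] q))"
      by (rule twisted_comult_recovers[OF X c, symmetric])
    also have "\<dots> = sw H H (comult H h) (\<lambda>h1 h2. sw D D (twisted_comult H D Y (c \<otimes>[C, H] h2))
        (\<lambda>p q. (S h1 * left_counit p) \<otimes>[H, D] q))"
      using c by (simp add: eq)
    also have "\<dots> = Y (c \<otimes>[C, H] h)"
      by (rule twisted_comult_recovers[OF Y c])
    finally show "X (c \<otimes>[C, H] h) = Y (c \<otimes>[C, H] h)" .
  qed (use assms in simp_all)
qed

section \<open>Equivalent twistings and isomorphic crossed coproducts\<close>

lemma sw_D_one:
  assumes "vspace U" "kbilinear D D U f" "c \<in> carr C"
  shows "sw D D (comult D (c \<otimes>[C, H] 1)) f = sw C C (comult C c) (\<lambda>c1 c2. f (c1 \<otimes>[C, H] 1) (c2 \<otimes>[C, H] 1))"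
  using assms
  by (simp add: sw_comult_pure[where U = U] sw_comult_one[where U = U]
      kbilinear_left[OF assms(2)] kbilinear_right[OF assms(2)])

text \<open>
  Both sides are right linear, and they agree on the elements \<open>c \<otimes> 1\<close>.
\<close>

lemma gauge_eq_colinear_map:
  assumes v: "klinear D H v"
    and eq: "\<And>d h. d \<in> carr D \<Longrightarrow> v (act D d h) = sw H H (comult H h) (\<lambda>h1 h2. S h1 * v d * h2)"
    and t: "t \<in> carr D"
  shows "gauge D v t = colinear_map (\<lambda>c. v (c \<otimes>[C, H] 1)) t"
proof -
  note [simp] = klinear_comp[OF v] D.gauge_linear[OF v]
  have u: "klinear C H (\<lambda>c. v (c \<otimes>[C, H] 1))" by simp
  show ?thesis
  proof (rule tensor_ext_D[where t = t and U = D and f = "gauge D v" and g = "colinear_map (\<lambda>c. v (c \<otimes>[C, H] 1))"])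
    fix c h assume c: "c \<in> carr C"
    have "gauge D v (c \<otimes>[C, H] h) = act D (gauge D v (c \<otimes>[C, H] 1)) h"
      using D.gauge_act[OF v eq, of "c \<otimes>[C, H] 1" h] c by simp
    also have "\<dots> = colinear_map (\<lambda>c. v (c \<otimes>[C, H] 1)) (c \<otimes>[C, H] h)"
      using c by (simp add: gauge_def sw_D_one[where U = D] D.sw_act colinear_map_pure[OF u])
    finally show "gauge D v (c \<otimes>[C, H] h) = colinear_map (\<lambda>c. v (c \<otimes>[C, H] 1)) (c \<otimes>[C, H] h)" .
  qed (use t colinear_map_linear[OF u klinear_id] in simp_all)
qed

text \<open>
  Left colinear, right linear coalgebra isomorphisms \<open>D\<^sup>\<tau> \<rightarrow> D\<^sup>\<tau>\<^sup>'\<close>, expressed through \<open>\<Delta>\<^sub>\<tau>\<close> and \<open>\<Delta>\<^sub>\<tau>\<^sub>'\<close>.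
\<close>

definition twisted_isomorphism ::
  "(('k, 'c, 'h) tensor \<Rightarrow> ('k, 'h, ('k, 'c, 'h) tensor) tensor) \<Rightarrow>
    (('k, 'c, 'h) tensor \<Rightarrow> ('k, 'h, ('k, 'c, 'h) tensor) tensor) \<Rightarrow>
    (('k, 'c, 'h) tensor \<Rightarrow> ('k, 'c, 'h) tensor) \<Rightarrow> bool" where
  "twisted_isomorphism \<tau> \<tau>' \<Phi> \<longleftrightarrow>
    klinear D D \<Phi> \<and>
    (\<forall>d\<in>carr D. twisted_comult H D \<tau>' (\<Phi> d) =
      sw D D (twisted_comult H D \<tau> d) (\<lambda>p q. \<Phi> p \<otimes>[D, D] \<Phi> q)) \<and>
    (\<forall>d\<in>carr D. counit D (\<Phi> d) = counit D d) \<and>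
    bij_betw \<Phi> (carr D) (carr D) \<and>
    left_colinear H C \<Phi> \<and>
    (\<forall>d\<in>carr D. \<forall>h. \<Phi> (act D d h) = act D (\<Phi> d) h)"

lemma equivalent_twistings_iff:
  "equivalent_twistings H D \<tau> \<tau>' \<longleftrightarrow> (\<exists>v. conv_invertible H D v \<and>
      (\<forall>d\<in>carr D. counit H (v d) = counit D d) \<and>
      (\<forall>d\<in>carr D. \<forall>h. v (act D d h) = sw H H (comult H h) (\<lambda>h1 h2. S h1 * v d * h2)) \<and>
      (\<forall>d\<in>carr D. equiv_left H D v \<tau>' d = equiv_right H D v \<tau> d))"
  by (simp only: equivalent_twistings_def equiv_left_def equiv_right_def)

context
  fixes \<tau> \<tau>'
  assumes \<tau>: "klinear D (H \<odot> D) \<tau>" and \<tau>': "klinear D (H \<odot> D) \<tau>'"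
    and twist': "module_coalgebra H (twist_coalg H D \<tau>')"
begin

text \<open>
  The isomorphism is \<open>d \<mapsto> d\<^sub>1\<cdot>v(d\<^sub>2)\<close>. It is the colinear map of \<open>u(c) = v(c \<otimes> 1)\<close>, and the colinear map
  of the convolution inverse of \<open>u\<close> is its inverse.
\<close>

lemma equivalence_gives_isomorphism:
  assumes "equivalent_twistings H D \<tau> \<tau>'"
  shows "\<exists>\<Phi>. twisted_isomorphism \<tau> \<tau>' \<Phi>"
proof -
  from assms obtain v where "conv_invertible H D v"
    and eps: "\<forall>d\<in>carr D. counit H (v d) = counit D d"
    and eq: "\<forall>d\<in>carr D. \<forall>h. v (act D d h) = sw H H (comult H h) (\<lambda>h1 h2. S h1 * v d * h2)"
    and E: "\<forall>d\<in>carr D. equiv_left H D v \<tau>' d = equiv_right H D v \<tau> d"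
    unfolding equivalent_twistings_iff by (elim exE conjE) (rule that)
  then obtain w where v: "klinear D H v" and w: "klinear D H w"
    and vw: "\<forall>d\<in>carr D. sw D D (comult D d) (\<lambda>d1 d2. v d1 * w d2) = scl H (counit D d) 1"
    and wv: "\<forall>d\<in>carr D. sw D D (comult D d) (\<lambda>d1 d2. w d1 * v d2) = scl H (counit D d) 1"
    unfolding conv_invertible_def by (elim exE conjE) (rule that)
  note eps = bspec[OF eps] and eq = bspec[OF eq, THEN spec] and E = bspec[OF E]
    and vw = bspec[OF vw] and wv = bspec[OF wv]
  note [simp] = klinear_comp[OF v] klinear_comp[OF w] v w
  let ?\<Phi> = "gauge D v"
  let ?u = "\<lambda>c. v (c \<otimes>[C, H] 1)" and ?u' = "\<lambda>c. w (c \<otimes>[C, H] 1)"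
  have u: "klinear C H ?u" and u': "klinear C H ?u'" by simp_all
  have col: "?\<Phi> t = colinear_map ?u t" if "t \<in> carr D" for t
    by (rule gauge_eq_colinear_map[OF v eq that])
  have conv: "convolution ?u ?u' c = scl H (counit C c) 1" "convolution ?u' ?u c = scl H (counit C c) 1"
    if c: "c \<in> carr C" for c
    using vw[of "c \<otimes>[C, H] 1"] wv[of "c \<otimes>[C, H] 1"] c
    by (simp_all add: convolution_def sw_D_one[where U = H])
  have \<Phi>: "klinear D D ?\<Phi>" by (rule D.gauge_linear[OF v])
  have act: "?\<Phi> (act D d h) = act D (?\<Phi> d) h" if "d \<in> carr D" for d h
    by (rule D.gauge_act[OF v eq that])
  have "bij_betw ?\<Phi> (carr D) (carr D)"
    by (rule bij_betw_byWitness[where f' = "colinear_map ?u'"])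
      (use u u' in \<open>auto simp: col colinear_map_convolution[OF u u'] colinear_map_convolution[OF u' u]
         colinear_map_unit conv colinear_map_in\<close>)
  moreover have "left_colinear H C ?\<Phi>"
    using left_colinear_colinear_map[OF u] by (simp add: left_colinear_iff col)
  moreover have "counit D (?\<Phi> d) = counit D d" if d: "d \<in> carr D" for d
  proof -
    have "counit D (?\<Phi> d) = sw D D (comult D d) (\<lambda>d1 d2. counit D (act D d1 (v d2)))"
      unfolding gauge_def by (rule klinear_sw[where X = D and U = ground]) (use d in simp_all)
    then show ?thesis
      using d by (simp add: eps sw_counit_counit)
  qed
  moreover have "twisted_comult H D \<tau>' (?\<Phi> d) = sw D D (twisted_comult H D \<tau> d) (\<lambda>p q. ?\<Phi> p \<otimes>[D, D] ?\<Phi> q)"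
    if d: "d \<in> carr D" for d
  proof -
    have "twisted_comult H D \<tau>' (?\<Phi> d) = twisted_comult H D (equiv_left H D v \<tau>') d"
      by (rule D.twisted_comult_gauge[OF v \<tau>' twist' d])
    also have "\<dots> = twisted_comult H D (equiv_right H D v \<tau>) d"
      unfolding twisted_comult_def by (rule sw_cong) (use d in \<open>simp_all add: E klinear_in[OF D.equiv_right_linear[OF v \<tau>]]\<close>)
    also have "\<dots> = sw D D (twisted_comult H D \<tau> d) (\<lambda>p q. ?\<Phi> p \<otimes>[D, D] ?\<Phi> q)"
      by (rule D.sw_twisted_comult_gauge[OF v \<tau> act d, symmetric])
    finally show ?thesis .
  qed
  ultimately show ?thesis
    using \<Phi> act unfolding twisted_isomorphism_def by blast
qed

text \<open>
  An isomorphism and its inverse are the colinear maps of some \<open>u\<close> and \<open>u'\<close>, which are convolution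
  inverse to each other. The equivariant extension of \<open>u\<close> is the required \<open>v\<close>: its map
  \<open>d \<mapsto> d\<^sub>1\<cdot>v(d\<^sub>2)\<close> is the given isomorphism, so compatibility with the comultiplications yields the
  equation for \<open>v\<close> by cancellation.
\<close>

lemma isomorphism_gives_equivalence:
  assumes "twisted_isomorphism \<tau> \<tau>' \<Phi>"
  shows "equivalent_twistings H D \<tau> \<tau>'"
proof -
  note iso = assms[unfolded twisted_isomorphism_def]
  note \<Phi> = iso[THEN conjunct1]
    and comult = iso[THEN conjunct2, THEN conjunct1, THEN bspec]
    and counit = iso[THEN conjunct2, THEN conjunct2, THEN conjunct1, THEN bspec]
    and bij = iso[THEN conjunct2, THEN conjunct2, THEN conjunct2, THEN conjunct1]
    and col = iso[THEN conjunct2, THEN conjunct2, THEN conjunct2, THEN conjunct2, THEN conjunct1]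
    and act = iso[THEN conjunct2, THEN conjunct2, THEN conjunct2, THEN conjunct2, THEN conjunct2, THEN bspec, THEN spec]
  note \<Phi>_in = klinear_in[OF \<Phi>]
  define \<Psi> where "\<Psi> = inv_into (carr D) \<Phi>"
  have \<Psi>_in: "\<Psi> t \<in> carr D" and \<Phi>\<Psi>: "\<Phi> (\<Psi> t) = t" and \<Psi>\<Phi>: "\<Psi> (\<Phi> t) = t" if "t \<in> carr D" for t
    unfolding \<Psi>_def using bij that
    by (auto simp: bij_betw_def inv_into_into f_inv_into_f)
  have inj: "x = y" if "\<Phi> x = \<Phi> y" "x \<in> carr D" "y \<in> carr D" for x y
    using bij that by (auto simp: bij_betw_def dest: inj_onD)
  have \<Psi>: "klinear D D \<Psi>"
    by (rule klinearI; (rule inj)?)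
      (simp_all add: \<Psi>_in \<Phi>\<Psi> vspace_add klinear_add[OF \<Phi>] klinear_scl[OF \<Phi>])
  have \<Psi>_act: "\<Psi> (act D t h) = act D (\<Psi> t) h" if "t \<in> carr D" for t h
    by (rule inj) (use that in \<open>simp_all add: \<Psi>_in \<Phi>\<Psi> act\<close>)
  have \<Psi>_col: "left_colinear H C \<Psi>"
    unfolding left_colinear_iff
  proof
    fix t assume t: "t \<in> carr D"
    note [simp] = klinear_comp[OF \<Phi>] klinear_comp[OF \<Psi>] \<Phi>_in \<Psi>_in \<Phi> \<Psi>
    have "left_coaction H C t = sw C D (left_coaction H C (\<Psi> t)) (\<lambda>c s. c \<otimes>[C, D] \<Phi> s)"
      using col \<Psi>_in[OF t] \<Phi>\<Psi>[OF t] unfolding left_colinear_iff by metis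
    then have "sw C D (left_coaction H C t) (\<lambda>c s. c \<otimes>[C, D] \<Psi> s) =
        sw C D (left_coaction H C (\<Psi> t)) (\<lambda>c s. c \<otimes>[C, D] s)"
      using t by (simp add: sw_sw[where U = "C \<odot> D"] sw_pure[where U = "C \<odot> D"] \<Psi>\<Phi> del: sw_pure_id)
    then show "left_coaction H C (\<Psi> t) = sw C D (left_coaction H C t) (\<lambda>c s. c \<otimes>[C, D] \<Psi> s)"
      using t by simp
  qed
  obtain u where u: "klinear C H u" and \<Phi>u: "\<And>t. t \<in> carr D \<Longrightarrow> \<Phi> t = colinear_map u t"
    and u_eq: "\<And>c. c \<in> carr C \<Longrightarrow> u c = left_counit (\<Phi> (c \<otimes>[C, H] 1))"
    using colinear_map_characterization[OF \<Phi> col act] by blast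
  obtain u' where u': "klinear C H u'" and \<Psi>u': "\<And>t. t \<in> carr D \<Longrightarrow> \<Psi> t = colinear_map u' t"
    using colinear_map_characterization[OF \<Psi> \<Psi>_col \<Psi>_act] by blast
  have conv: "convolution u u' c = scl H (counit C c) 1" "convolution u' u c = scl H (counit C c) 1"
    if c: "c \<in> carr C" for c
  proof -
    let ?d = "c \<otimes>[C, H] 1"
    have d: "?d \<in> carr D" using c by simp
    have "convolution u u' c = left_counit (colinear_map (convolution u u') ?d)"
      using left_counit_colinear_map[OF klinear_convolution[OF u u'] c, of 1] by simp
    also have "colinear_map (convolution u u') ?d = ?d"
      using colinear_map_convolution[OF u u' d] \<Phi>\<Psi>[OF d] \<Phi>u \<Psi>u' \<Psi>_in d by simp
    finally show "convolution u u' c = scl H (counit C c) 1" using c by simp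
    have "convolution u' u c = left_counit (colinear_map (convolution u' u) ?d)"
      using left_counit_colinear_map[OF klinear_convolution[OF u' u] c, of 1] by simp
    also have "colinear_map (convolution u' u) ?d = ?d"
      using colinear_map_convolution[OF u' u d] \<Psi>\<Phi>[OF d] \<Phi>u \<Psi>u' \<Phi>_in d by simp
    finally show "convolution u' u c = scl H (counit C c) 1" using c by simp
  qed
  define v where "v = equivariant_extension u"
  have v: "klinear D H v"
    unfolding v_def by (rule equivariant_extension_linear'[OF u])
  have inv: "conv_invertible H D v"
    unfolding conv_invertible_def v_def
    using equivariant_extension_linear'[OF u] equivariant_extension_linear'[OF u']
      equivariant_extension_inverse[OF u u' conv(1)] equivariant_extension_inverse[OF u' u conv(2)]
    by blast
  have eps: "counit H (v d) = counit D d" if "d \<in> carr D" for d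
    unfolding v_def
    by (rule counit_equivariant_extension[OF u _ that])
      (simp add: u_eq counit_left_counit \<Phi>_in counit)
  have eq: "v (act D d h) = sw H H (comult H h) (\<lambda>h1 h2. S h1 * v d * h2)" if "d \<in> carr D" for d h
    unfolding v_def by (rule equivariant_extension_act[OF u that])
  have gauge: "gauge D v d = \<Phi> d" if "d \<in> carr D" for d
    unfolding v_def using gauge_equivariant_extension[OF u that] \<Phi>u[OF that] by simp
  have "twisted_comult H D (equiv_left H D v \<tau>') d = twisted_comult H D (equiv_right H D v \<tau>) d"
    if d: "d \<in> carr D" for d
  proof -
    have "twisted_comult H D (equiv_left H D v \<tau>') d = twisted_comult H D \<tau>' (\<Phi> d)"
      using D.twisted_comult_gauge[OF v \<tau>' twist' d] gauge[OF d] by simp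
    also have "\<dots> = sw D D (twisted_comult H D \<tau> d) (\<lambda>p q. gauge D v p \<otimes>[D, D] gauge D v q)"
      unfolding comult[OF d]
      by (rule sw_cong) (use klinear_in[OF D.twisted_comult_linear[OF \<tau>] d] in \<open>simp_all add: gauge\<close>)
    also have "\<dots> = twisted_comult H D (equiv_right H D v \<tau>) d"
      by (rule D.sw_twisted_comult_gauge[OF v \<tau> _ d]) (simp add: gauge act)
    finally show ?thesis .
  qed
  then have "equiv_left H D v \<tau>' d = equiv_right H D v \<tau> d" if "d \<in> carr D" for d
    by (rule twisted_comult_cancel[OF D.equiv_left_linear[OF v \<tau>'] D.equiv_right_linear[OF v \<tau>] _ that])
  with inv eps eq show ?thesis
    unfolding equivalent_twistings_iff by blast
qed

end

text \<open>
  The crossed coproducts share vector space, counit and action with \<open>D\<close>, and their comultiplications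
  are \<open>\<Delta>\<^sub>\<tau>\<close> and \<open>\<Delta>\<^sub>\<tau>\<^sub>'\<close>.
\<close>

lemma crossed_coproduct_isomorphism_iff:
  assumes "normalized H D \<tau>" "module_coalgebra H (twist_coalg H D \<tau>)" "corresponds H C \<tau> \<rho> \<alpha>"
    and "normalized H D \<tau>'" "module_coalgebra H (twist_coalg H D \<tau>')" "corresponds H C \<tau>' \<rho>' \<alpha>'"
  shows "twisted_isomorphism \<tau> \<tau>' \<Phi> \<longleftrightarrow>
    coalgebra_map (crossed_coproduct H C \<rho> \<alpha>) (crossed_coproduct H C \<rho>' \<alpha>') \<Phi> \<and>
    bij_betw \<Phi> (carr (crossed_coproduct H C \<rho> \<alpha>)) (carr (crossed_coproduct H C \<rho>' \<alpha>')) \<and>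
    left_colinear H C \<Phi> \<and>
    right_linear (crossed_coproduct H C \<rho> \<alpha>) (crossed_coproduct H C \<rho>' \<alpha>') \<Phi>"
proof -
  let ?K = "crossed_coproduct H C \<rho> \<alpha>" and ?K' = "crossed_coproduct H C \<rho>' \<alpha>'"
  have K: "carr ?K = carr D" "scl ?K = scl D" "counit ?K = counit D" "act ?K = act D"
    and K': "carr ?K' = carr D" "scl ?K' = scl D" "counit ?K' = counit D" "act ?K' = act D"
    by (simp_all only: crossed_coproduct_def tensor_coalg_def vs.simps coalg.simps mcoalg.simps)
  note c = sw_left_cong[OF K(1,2)] sw_right_cong[OF K(1,2)] klinear_dom_cong[OF K(1,2)]
    klinear_ran_cong[OF K'(1,2)] pure_left_cong[OF K'(1,2)] pure_right_cong[OF K'(1,2)]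
  have comult: "comult ?K t = twisted_comult H D \<tau> t" "comult ?K' t = twisted_comult H D \<tau>' t"
    if "t \<in> carr D" for t
    using comult_crossed_coproduct[OF assms(1,2) _ _ that, of \<rho> \<alpha>]
      comult_crossed_coproduct[OF assms(4,5) _ _ that, of \<rho>' \<alpha>'] assms(3,6)
    unfolding corresponds_def by blast+
  have "klinear D D \<Phi> \<Longrightarrow> (\<forall>d\<in>carr D. comult ?K' (\<Phi> d) = sw D D (comult ?K d) (\<lambda>p q. \<Phi> p \<otimes>[D, D] \<Phi> q)) \<longleftrightarrow>
      (\<forall>d\<in>carr D. twisted_comult H D \<tau>' (\<Phi> d) = sw D D (twisted_comult H D \<tau> d) (\<lambda>p q. \<Phi> p \<otimes>[D, D] \<Phi> q))"
    by (intro ball_cong refl) (simp only: comult klinear_in[of D D \<Phi>])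
  then show ?thesis
    unfolding twisted_isomorphism_def coalgebra_map_def right_linear_def
    by (simp only: c K K') blast
qed

end

theorem theorem3p5:
  fixes H :: "('k::field, 'h::ring_1) hopf"
    and C :: "('k, 'h, 'c::ab_group_add) mcoalg"
    and \<tau> \<tau>' :: "('k, 'c, 'h) tensor \<Rightarrow> ('k, 'h, ('k, 'c, 'h) tensor) tensor"
    and \<rho> \<rho>' :: "'c \<Rightarrow> ('k, 'h, 'c) tensor"
    and \<alpha> \<alpha>' :: "'c \<Rightarrow> ('k, 'h, 'h) tensor"
  assumes "hopf_algebra H" and "bij (antipode H)"
    and "module_coalgebra H C"
    and "twisting H (tensor_coalg H C) \<tau>" and "twisting H (tensor_coalg H C) \<tau>'"
    and "corresponds H C \<tau> \<rho> \<alpha>" and "corresponds H C \<tau>' \<rho>' \<alpha>'"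
  shows "equivalent_twistings H (tensor_coalg H C) \<tau> \<tau>' \<longleftrightarrow>
    (\<exists>\<Phi>. coalgebra_map (crossed_coproduct H C \<rho> \<alpha>) (crossed_coproduct H C \<rho>' \<alpha>') \<Phi> \<and>
      bij_betw \<Phi> (carr (crossed_coproduct H C \<rho> \<alpha>)) (carr (crossed_coproduct H C \<rho>' \<alpha>')) \<and>
      left_colinear H C \<Phi> \<and>
      right_linear (crossed_coproduct H C \<rho> \<alpha>) (crossed_coproduct H C \<rho>' \<alpha>') \<Phi>)"
proof -
  interpret hopf_coalgebra H C
    using assms(1,3) unfolding module_coalgebra_def by unfold_locales blast+
  have n: "normalized H D \<tau>" "normalized H D \<tau>'"
    and m: "module_coalgebra H (twist_coalg H D \<tau>)" "module_coalgebra H (twist_coalg H D \<tau>')"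
    using assms(4,5) unfolding twisting_def by blast+
  have l: "klinear D (H \<odot> D) \<tau>" "klinear D (H \<odot> D) \<tau>'"
    using n unfolding normalized_def by blast+
  have "equivalent_twistings H D \<tau> \<tau>' \<longleftrightarrow> (\<exists>\<Phi>. twisted_isomorphism \<tau> \<tau>' \<Phi>)"
    using equivalence_gives_isomorphism[OF l m(2)] isomorphism_gives_equivalence[OF l m(2)] by blast
  then show ?thesis
    by (simp only: crossed_coproduct_isomorphism_iff[OF n(1) m(1) assms(6) n(2) m(2) assms(7)])
qed

end
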